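(* There is an $\epsilon > 0$ such that the following holds: if $A \subset \mathbb{R}$ is a finite set with $|AA| \leq |A|^{1+\epsilon}$ and $B \subset \mathbb{R}$ is an arbitrary additive basis for $A$ (that is, $A \subseteq B+B$), then $$|B| \gg |A|^{1/2 + 1/442 - o(1)},$$ where $o(1)$ denotes a quantity tending to $0$ as $|A| \to \infty$.
   Context: For finite sets $X,Y \subset \mathbb{R}$, $X+Y=\{x+y : x\in X, y\in Y\}$ and $XY = \{xy : x \in X, y \in Y\}$. The notation $U \gg V$ means $|V| \leq c|U|$ for some absolute constant $c>0$. *)

theory Defs
  imports Complex_Main "HOL-Library.Set_Algebras"
begin

end

theory Submission
  imports Defs "HOL-Analysis.Convex"
begin

text \<open>
  Write \<open>n = |A|\<close>, \<open>M = |B|\<close>, \<open>V = AA\<close>, and let \<open>E\<close> be the additive energy of \<open>V\<close>; by Petridis's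
  argument all sets \<open>A\<^sup>k\<close> have size about \<open>n\<close>. Two estimates for \<open>E\<close> are played against each other.

  Lower bound. For \<open>x, y, y' \<in> B\<close> with \<open>x + y, x + y' \<in> A\<close> and every \<open>c \<in> A\<close>, the elements \<open>c(x + y)\<close>
  and \<open>c(x + y')\<close> of \<open>V\<close> differ by \<open>c(y - y')\<close>, which is a popular difference of \<open>V\<close> as soon as
  \<open>y\<close> and \<open>y'\<close> have many common neighbours \<open>x\<close>. Two triples with the same ratio
  \<open>(x + y) / (x + y')\<close> correspond to a collinear triple of the grid \<open>(B \<union> -B)\<^sup>2\<close>, so
  Szemeredi--Trotter gives many ratios, and \<open>E\<close> is at least about \<open>n\<^sup>7 / M\<^sup>9\<close>.

  Upper bound. The matrix \<open>r(a - a')\<close>, where \<open>r\<close> counts representations as a difference of elements of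
  \<open>V\<close>, is a Gram matrix, so the sum of \<open>r(a - b) r(b - c) r(a - c)\<close> over \<open>V\<^sup>3\<close> is at least
  \<open>(E / |V|)\<^sup>3\<close>. By Cauchy--Schwarz this sum is controlled by the sum of \<open>r\<^sup>3\<close> and by the number of
  solutions of \<open>d\<^sub>1 - d\<^sub>2 = d\<^sub>3\<close> in level sets of \<open>r\<close>. These level sets are almost invariant under
  multiplication by \<open>A\<close>, so Szemeredi--Trotter bounds both, and \<open>E\<close> is at most about \<open>n\<close> to the power
  \<open>22/9\<close>. Hence \<open>M\<close> is at least about \<open>n\<close> to the power \<open>41/81\<close>, which exceeds \<open>1/2 + 1/442\<close>.
\<close>

section \<open>Rich lines in grids\<close>

text \<open>Choose one representative in each fibre of \<open>h\<close>, at most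
  \<open>card I\<close> in total. Every other element is paired with the representative of its
  fibre, and these pairs are distinct.\<close>

lemma card_le_same_fiber_pairs:
  assumes "finite S" "finite I" "h ` S \<subseteq> I"
  shows "card S \<le> card I + card {(x, x'). x \<in> S \<and> x' \<in> S \<and> x \<noteq> x' \<and> h x = h x'}"
proof -
  define rep where "rep i = (SOME x. x \<in> S \<and> h x = i)" for i
  have rep: "rep (h x) \<in> S \<and> h (rep (h x)) = h x" if "x \<in> S" for x
    unfolding rep_def by (rule someI[of _ x]) (use that in auto)
  let ?R = "rep ` h ` S"
  let ?P = "{(x, x'). x \<in> S \<and> x' \<in> S \<and> x \<noteq> x' \<and> h x = h x'}"
  have finP: "finite ?P"
    by (rule finite_subset[of _ "S \<times> S"]) (use assms in auto)
  have "card (S - ?R) \<le> card ?P"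
  proof (rule card_inj_on_le[of "\<lambda>x. (x, rep (h x))"])
    show "inj_on (\<lambda>x. (x, rep (h x))) (S - ?R)" by (auto intro: inj_onI)
    show "(\<lambda>x. (x, rep (h x))) ` (S - ?R) \<subseteq> ?P"
      using rep by force
  qed (fact finP)
  moreover have "card ?R \<le> card I"
    using assms by (meson card_image_le card_mono finite_imageI finite_subset le_trans)
  moreover have "card S \<le> card (S - ?R) + card ?R"
  proof -
    have "S \<subseteq> (S - ?R) \<union> ?R" by auto
    then have "card S \<le> card ((S - ?R) \<union> ?R)"
      using assms by (intro card_mono) auto
    also have "\<dots> \<le> card (S - ?R) + card ?R" by (rule card_Un_le)
    finally show ?thesis .
  qed
  ultimately show ?thesis by linarith
qed

text \<open>The rank of \<open>x\<close> in \<open>X\<close>, divided by \<open>p\<close>: the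
  sorted set is cut into runs of \<open>p\<close> consecutive points. Counting smaller elements
  makes the index monotone in \<open>x\<close> without enumerating \<open>X\<close>.\<close>

definition block :: "nat \<Rightarrow> real set \<Rightarrow> real \<Rightarrow> nat" where
  "block p X x = card {z \<in> X. z < x} div p"

lemma block_mono: "finite X \<Longrightarrow> x \<le> x' \<Longrightarrow> block p X x \<le> block p X x'"
  unfolding block_def by (intro div_le_mono card_mono) auto

lemma block_le:
  assumes "finite X" "x \<in> X"
  shows "block p X x \<le> (card X - 1) div p"
proof -
  have "card {z \<in> X. z < x} \<le> card (X - {x})"
    using assms by (intro card_mono) auto
  then show ?thesis
    unfolding block_def using assms by (intro div_le_mono) simp
qed

lemma card_block_le:
  assumes "finite X" "p > 0"
  shows "card {x \<in> X. block p X x = k} \<le> p"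
proof -
  have strict: "card {z \<in> X. z < x} < card {z \<in> X. z < x'}" if "x \<in> X" "x < x'" for x x'
    using assms that by (intro psubset_card_mono) auto
  have "card {x \<in> X. block p X x = k} \<le> card {k * p ..< k * p + p}"
  proof (rule card_inj_on_le[of "\<lambda>x. card {z \<in> X. z < x}"])
    show "inj_on (\<lambda>x. card {z \<in> X. z < x}) {x \<in> X. block p X x = k}"
      using strict by (intro inj_onI) (metis (mono_tags, lifting) linorder_cases mem_Collect_eq nat_neq_iff)
    show "(\<lambda>x. card {z \<in> X. z < x}) ` {x \<in> X. block p X x = k} \<subseteq> {k * p..<k * p + p}"
      using assms(2) by (auto simp: block_def dividend_less_div_times div_times_less_eq_dividend)
         (metis add.commute dividend_less_div_times)
  qed simp
  then show ?thesis by simp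
qed

text \<open>A line of nonzero slope is monotone, so it runs through a staircase of at most
  \<open>u + w + 1\<close> cells, and each further point on it yields a pair of points in a common
  cell. Two distinct points determine their line, so no pair is counted for two lines, and a cell
  has at most \<open>p * q\<close> points.\<close>

lemma rich_lines_cells:
  fixes X Y :: "real set" and L :: "(real \<times> real) set"
  assumes fin: "finite X" "finite Y" "finite L" and pq: "p > 0" "q > 0"
    and L: "\<And>c d. (c, d) \<in> L \<Longrightarrow> c \<noteq> 0 \<and> t \<le> card {x \<in> X. c * x + d \<in> Y}"
  shows "card L * (t - ((card X - 1) div p + (card Y - 1) div q + 1)) \<le> card X * p * (card Y * q)"
proof -
  define u where "u = (card X - 1) div p"
  define w where "w = (card Y - 1) div q"
  define S where "S = (\<lambda>(c, d). {x \<in> X. c * x + d \<in> Y})"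
  define cell where "cell = (\<lambda>(x, y). (block p X x, block q Y y))"
  define pt where "pt = (\<lambda>(c::real, d) x. (x, c * x + d))"
  define Q where "Q l = {(x, x'). x \<in> S l \<and> x' \<in> S l \<and> x \<noteq> x' \<and> cell (pt l x) = cell (pt l x')}" for l
  define P where "P = (SIGMA z : X \<times> Y. {z' \<in> X \<times> Y. cell z' = cell z})"
  have finS: "finite (S l)" for l using fin by (cases l) (auto simp: S_def)
  have finQ: "finite (Q l)" for l
    by (rule finite_subset[of _ "S l \<times> S l"]) (use finS in \<open>auto simp: Q_def\<close>)
  have Q: "t - (u + w + 1) \<le> card (Q l)" if l: "l \<in> L" for l
  proof -
    obtain c d where cd: "l = (c, d)" by (cases l)
    with L l have c0: "c \<noteq> 0" and t: "t \<le> card (S l)" by (auto simp: S_def)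
    \<comment> \<open>Along the line both block indices grow if the slope is positive, and they move
      in opposite directions if it is negative. So this signed sum is monotone in \<open>x\<close>,
      and equal values force both indices to agree.\<close>
    define h where "h x = int (block p X x) + (if c > 0 then 1 else -1) * int (block q Y (c * x + d))" for x
    define I where "I = (if c > 0 then {0..int (u + w)} else {- int w..int u})"
    have hI: "h ` S l \<subseteq> I"
    proof
      fix k assume "k \<in> h ` S l"
      then obtain x where x: "x \<in> X" "c * x + d \<in> Y" "k = h x" by (auto simp: S_def cd)
      have "block p X x \<le> u" "block q Y (c * x + d) \<le> w"
        using block_le fin x unfolding u_def w_def by blast+
      then show "k \<in> I" by (auto simp: x h_def I_def)
    qed
    have key: "cell (pt l x) = cell (pt l x')" if "x < x'" "h x = h x'" for x x'
    proof -
      have bx: "block p X x \<le> block p X x'" using fin that by (intro block_mono) auto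
      show ?thesis
      proof (cases "c > 0")
        case True
        then have "block q Y (c * x + d) \<le> block q Y (c * x' + d)"
          using fin that by (intro block_mono) auto
        with bx that True show ?thesis by (auto simp: h_def cell_def pt_def cd)
      next
        case False
        then have "block q Y (c * x' + d) \<le> block q Y (c * x + d)"
          using fin that by (intro block_mono) (auto intro: mult_left_mono_neg)
        with bx that False show ?thesis by (auto simp: h_def cell_def pt_def cd)
      qed
    qed
    have key': "cell (pt l x) = cell (pt l x')" if "x \<noteq> x'" "h x = h x'" for x x'
      using key[of x x'] key[of x' x] that by (cases "x < x'") auto
    have "card (S l) \<le> card I + card {(x, x'). x \<in> S l \<and> x' \<in> S l \<and> x \<noteq> x' \<and> h x = h x'}"
      by (rule card_le_same_fiber_pairs[OF finS _ hI]) (simp add: I_def)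
    also have "card {(x, x'). x \<in> S l \<and> x' \<in> S l \<and> x \<noteq> x' \<and> h x = h x'} \<le> card (Q l)"
      using finQ key' by (intro card_mono) (auto simp: Q_def)
    also have "card I = u + w + 1" by (auto simp: I_def nat_add_distrib)
    finally show ?thesis using t by linarith
  qed
  have "card L * (t - (u + w + 1)) \<le> (\<Sum>l\<in>L. card (Q l))"
    using sum_mono[of L "\<lambda>_. t - (u + w + 1)" "\<lambda>l. card (Q l)"] Q by simp
  also have "\<dots> = card (SIGMA l : L. Q l)" using fin finQ by simp
  also have "\<dots> \<le> card P"
  proof (rule card_inj_on_le[of "\<lambda>(l, x, x'). (pt l x, pt l x')"])
    show "inj_on (\<lambda>(l, x, x'). (pt l x, pt l x')) (SIGMA l : L. Q l)"
    proof (rule inj_onI, clarsimp simp: pt_def Q_def)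
      fix c d x x' c' d'
      assume "x \<noteq> x'" and e: "c * x + d = c' * x + d'" "c * x' + d = c' * x' + (d' :: real)"
      from e have "(c - c') * (x - x') = 0" by (simp add: algebra_simps)
      with \<open>x \<noteq> x'\<close> have "c = c'" by simp
      with e show "c = c' \<and> d = d'" by simp
    qed
    show "(\<lambda>(l, x, x'). (pt l x, pt l x')) ` (SIGMA l : L. Q l) \<subseteq> P"
      by (auto simp: P_def Q_def S_def pt_def)
    show "finite P"
      unfolding P_def using fin by (intro finite_SigmaI) auto
  qed
  also have "card P = (\<Sum>z\<in>X \<times> Y. card {z' \<in> X \<times> Y. cell z' = cell z})"
    unfolding P_def using fin by (subst card_SigmaI) auto
  also have "\<dots> \<le> (\<Sum>z\<in>X \<times> Y. p * q)"
  proof (rule sum_mono)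
    fix z assume "z \<in> X \<times> Y"
    have "{z' \<in> X \<times> Y. cell z' = cell z}
        = {x \<in> X. block p X x = fst (cell z)} \<times> {y \<in> Y. block q Y y = snd (cell z)}"
      by (auto simp: cell_def split: prod.splits)
    then show "card {z' \<in> X \<times> Y. cell z' = cell z} \<le> p * q"
      using card_block_le fin pq by (simp add: card_cartesian_product mult_le_mono)
  qed
  also have "\<dots> = card X * p * (card Y * q)" by (simp add: card_cartesian_product)
  finally show ?thesis unfolding u_def w_def .
qed

text \<open>Szemeredi--Trotter for grids: cutting both sides into about \<open>t / 4\<close> intervals, a line
  meets at most about \<open>t / 2\<close> cells, hence has about \<open>t / 2\<close> pairs of points inside a cell.\<close>

lemma rich_lines_bound:
  fixes X Y :: "real set" and L :: "(real \<times> real) set"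
  assumes fin: "finite X" "finite Y" "finite L" and t: "t \<ge> 2"
    and L: "\<And>c d. (c, d) \<in> L \<Longrightarrow> c \<noteq> 0 \<and> t \<le> card {x \<in> X. c * x + d \<in> Y}"
  shows "real (card L) * real t ^ 3 \<le> 100 * real (card X) ^ 2 * real (card Y) ^ 2"
proof (cases "L = {}")
  case False
  then obtain c d where cd: "(c, d) \<in> L" by auto
  have tX: "t \<le> card X"
    using L[OF cd] card_mono[of X "{x \<in> X. c * x + d \<in> Y}"] fin by auto
  have tY: "t \<le> card Y"
  proof -
    have "card {x \<in> X. c * x + d \<in> Y} \<le> card Y"
      by (rule card_inj_on_le[of "\<lambda>x. c * x + d"]) (use L[OF cd] fin in \<open>auto intro: inj_onI\<close>)
    then show ?thesis using L[OF cd] by auto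
  qed
  note cells = rich_lines_cells[OF fin _ _ L]
  show ?thesis
  proof (cases "t < 4")
    case True
    \<comment> \<open>Here the whole grid is one cell: each line keeps \<open>t - 1 \<ge> 1\<close>
      pairs, and \<open>t ^ 3 \<le> 27\<close>.\<close>
    have "card L * (t - ((card X - 1) div card X + (card Y - 1) div card Y + 1))
        \<le> card X * card X * (card Y * card Y)"
      by (rule cells) (use tX tY t in auto)
    moreover have "(card X - 1) div card X = 0" "(card Y - 1) div card Y = 0"
      using tX tY t by auto
    ultimately have "card L * (t - 1) \<le> card X * card X * (card Y * card Y)" by simp
    moreover have "card L * 1 \<le> card L * (t - 1)" using t by (intro mult_le_mono2) linarith
    ultimately have "card L \<le> card X * card X * (card Y * card Y)" by linarith
    then have "real (card L) \<le> real (card X * card X * (card Y * card Y))" by (simp only: of_nat_le_iff)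
    then have 1: "real (card L) \<le> real (card X) ^ 2 * real (card Y) ^ 2" by (simp add: power2_eq_square)
    have "real t ^ 3 \<le> 3 ^ 3" using True by (intro power_mono) auto
    then have "real (card L) * real t ^ 3 \<le> (real (card X) ^ 2 * real (card Y) ^ 2) * 100"
      using 1 by (intro mult_mono) auto
    then show ?thesis by simp
  next
    case False
    \<comment> \<open>With blocks of size about \<open>4 * m / t\<close> the largest block index
      stays below \<open>t / 4\<close>. Doing this on both sides leaves at least
      \<open>t / 4\<close> pairs per line, and the final constant is
      \<open>100 = 4 * 5 * 5\<close>.\<close>
    have block_size: "\<exists>p>0. 4 * ((m - 1) div p) < t \<and> real p * real t \<le> 5 * real m" if "t \<le> m" for m
    proof -
      define p where "p = 4 * m div t + 1"
      define u where "u = (m - 1) div p"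
      have "p * t = 4 * m div t * t + t" by (simp add: p_def)
      moreover have "4 * m div t * t \<le> 4 * m" by (rule div_times_less_eq_dividend)
      moreover have "4 * m < t + 4 * m div t * t" using t by (intro dividend_less_div_times) auto
      ultimately have pt: "4 * m < p * t" "p * t \<le> 5 * m" using that by linarith+
      have "u * p \<le> m - 1" unfolding u_def by (rule div_times_less_eq_dividend)
      then have "u * p < m" using that t by linarith
      have "(4 * u) * m = u * (4 * m)" by (simp only: mult_ac)
      also have "\<dots> \<le> u * (p * t)" using pt by (intro mult_le_mono2) auto
      also have "\<dots> = (u * p) * t" by (simp only: mult_ac)
      also have "\<dots> < m * t" using \<open>u * p < m\<close> t by (intro mult_strict_right_mono) auto
      finally have "4 * u < t" by (metis mult.commute mult_less_cancel2)
      moreover have "real (p * t) \<le> real (5 * m)" using pt by (simp only: of_nat_le_iff)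
      moreover have "p > 0" by (simp add: p_def)
      ultimately show ?thesis unfolding u_def by (intro exI[of _ p]) simp
    qed
    obtain p where p: "p > 0" "4 * ((card X - 1) div p) < t" "real p * real t \<le> 5 * real (card X)"
      using block_size[OF tX] by blast
    obtain q where q: "q > 0" "4 * ((card Y - 1) div q) < t" "real q * real t \<le> 5 * real (card Y)"
      using block_size[OF tY] by blast
    have "t \<le> 4 * (t - ((card X - 1) div p + (card Y - 1) div q + 1))"
      using p(2) q(2) False by linarith
    then have "card L * t \<le> card L * (4 * (t - ((card X - 1) div p + (card Y - 1) div q + 1)))"
      by (rule mult_le_mono2)
    also have "\<dots> \<le> 4 * (card X * p * (card Y * q))"
      using cells[OF p(1) q(1)] by simp
    finally have "real (card L * t) \<le> real (4 * (card X * p * (card Y * q)))" by (simp only: of_nat_le_iff)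
    then have "(real (card L) * real t) * real t ^ 2
        \<le> (4 * (real (card X) * real p * (real (card Y) * real q))) * real t ^ 2"
      by (intro mult_right_mono) auto
    also have "\<dots> = 4 * real (card X) * real (card Y) * ((real p * real t) * (real q * real t))"
      by (simp add: power2_eq_square)
    also have "\<dots> \<le> 4 * real (card X) * real (card Y) * ((5 * real (card X)) * (5 * real (card Y)))"
      by (intro mult_left_mono mult_mono[OF p(3) q(3)]) auto
    finally show ?thesis by (simp add: power2_eq_square power3_eq_cube mult_ac)
  qed
qed simp

text \<open>Layer-cake summation: the level \<open>t\<close> has weight \<open>3 * t ^ 2\<close>, so
  it contributes at most \<open>3 * C / t\<close>. This turns a Szemeredi--Trotter bound on level
  sets into a third moment at the cost of a harmonic sum.\<close>

lemma sum_cube_le_if_card_ge_le: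
  fixes f :: "'a \<Rightarrow> nat"
  assumes fin: "finite S" and F: "\<And>s. s \<in> S \<Longrightarrow> f s \<le> F"
    and C: "\<And>t. 1 \<le> t \<Longrightarrow> t \<le> F \<Longrightarrow> real (card {s \<in> S. t \<le> f s}) * real t ^ 3 \<le> C"
  shows "(\<Sum>s\<in>S. real (f s) ^ 3) \<le> 3 * C * (\<Sum>t=1..F. 1 / real t)"
proof -
  have cube: "real m ^ 3 \<le> (\<Sum>t=1..m. 3 * real t ^ 2)" for m
    by (induction m) (auto simp: power2_eq_square power3_eq_cube algebra_simps)
  have "(\<Sum>s\<in>S. real (f s) ^ 3) \<le> (\<Sum>s\<in>S. \<Sum>t=1..F. if t \<le> f s then 3 * real t ^ 2 else 0)"
  proof (rule sum_mono)
    fix s assume "s \<in> S"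
    then have "{1..F} \<inter> {t. t \<le> f s} = {1..f s}" using F by force
    then have "(\<Sum>t=1..F. if t \<le> f s then 3 * real t ^ 2 else 0) = (\<Sum>t=1..f s. 3 * real t ^ 2)"
      by (simp add: sum.If_cases)
    then show "real (f s) ^ 3 \<le> (\<Sum>t=1..F. if t \<le> f s then 3 * real t ^ 2 else 0)"
      using cube by simp
  qed
  also have "\<dots> = (\<Sum>t=1..F. \<Sum>s\<in>S. if t \<le> f s then 3 * real t ^ 2 else 0)"
    by (rule sum.swap)
  also have "\<dots> \<le> (\<Sum>t=1..F. 3 * C * (1 / real t))"
  proof (rule sum_mono)
    fix t assume "t \<in> {1..F}"
    then have t: "1 \<le> t" "t \<le> F" by auto
    have "(\<Sum>s\<in>S. if t \<le> f s then 3 * real t ^ 2 else 0) = 3 * real t ^ 2 * real (card {s \<in> S. t \<le> f s})"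
      using fin by (simp add: sum.If_cases Int_def)
    also have "\<dots> = 3 * (real (card {s \<in> S. t \<le> f s}) * real t ^ 3) * (1 / real t)"
      using t by (simp add: power2_eq_square power3_eq_cube)
    also have "\<dots> \<le> 3 * C * (1 / real t)"
      using C[OF t] by (intro mult_right_mono) auto
    finally show "(\<Sum>s\<in>S. if t \<le> f s then 3 * real t ^ 2 else 0) \<le> 3 * C * (1 / real t)" .
  qed
  finally show ?thesis by (simp add: sum_distrib_left)
qed

lemma sum_inverse_le_ln: "(\<Sum>t=1..m. 1 / real t) \<le> 1 + ln (real m)"
proof (induction m)
  case (Suc m)
  show ?case
  proof (cases "m = 0")
    case False
    have "ln (real m / (real m + 1)) \<le> real m / (real m + 1) - 1"
      using False by (intro ln_le_minus_one) auto
    then have "1 / (real m + 1) \<le> ln (real m + 1) - ln (real m)"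
      using False by (simp add: ln_div field_simps)
    with Suc show ?thesis by (simp add: add.commute)
  qed simp
qed simp

section \<open>Growth of product sets\<close>

lemma zero_notin_set_power: "0 \<notin> A \<Longrightarrow> 0 \<notin> (A :: real set) ^ k"
  by (induction k) (auto simp: set_times_def)

lemma finite_set_power: "finite A \<Longrightarrow> finite ((A :: real set) ^ k)"
  by (induction k) (auto simp: finite_set_times)

lemma card_le_card_set_times:
  assumes "finite A" "finite X" "x \<in> X" "x \<noteq> (0::real)"
  shows "card A \<le> card (A * X)"
proof (rule card_inj_on_le[of "\<lambda>a. a * x"])
  show "(\<lambda>a. a * x) ` A \<subseteq> A * X" using assms by auto
  show "finite (A * X)" using assms by (simp add: finite_set_times)
qed (use assms in \<open>auto intro: inj_onI\<close>)

text \<open>Induction on \<open>C\<close>. When \<open>c\<close> is added, let \<open>Z\<close> be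
  the set of \<open>x\<close> with \<open>c * x * A\<close> already inside \<open>C * X * A\<close>.
  New triple products lie in \<open>c * (X * A)\<close> outside \<open>c * (Z * A)\<close>, while
  \<open>C * X\<close> gains all \<open>c * x\<close> with \<open>x\<close> outside
  \<open>Z\<close>. The hypothesis \<open>min\<close>, applied to \<open>Z\<close>, balances the two
  changes.\<close>

lemma petridis:
  fixes X A C :: "real set"
  assumes fin: "finite X" "finite A" "finite C" and "0 \<notin> C"
    and min: "\<And>Z. Z \<subseteq> X \<Longrightarrow> card (X * A) * card Z \<le> card (Z * A) * card X"
  shows "card (C * X * A) * card X \<le> card (X * A) * card (C * X)"
  using fin(3) \<open>0 \<notin> C\<close>
proof (induction C rule: finite_induct)
  case empty
  have "({} :: real set) * Y = {}" for Y by (auto simp: set_times_def)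
  then show ?case by simp
next
  case (insert c C)
  then have c: "c \<noteq> 0" by auto
  define Z where "Z = {x \<in> X. (\<lambda>a. c * x * a) ` A \<subseteq> C * X * A}"
  have finZ: "finite Z" "Z \<subseteq> X" using fin by (auto simp: Z_def)
  have fins: "finite (C * X * A)" "finite (X * A)" "finite (Z * A)" "finite (C * X)"
    using fin insert finZ by (auto intro!: finite_set_times)
  have card_c: "card ((\<lambda>y. c * y) ` Y) = card Y" for Y
    using c by (intro card_image) (auto intro: inj_onI)
  have "insert c C * X * A \<subseteq> C * X * A \<union> ((\<lambda>y. c * y) ` (X * A) - (\<lambda>y. c * y) ` (Z * A))"
  proof
    fix w assume "w \<in> insert c C * X * A"
    then obtain k x a where w: "w = k * x * a" "k \<in> insert c C" "x \<in> X" "a \<in> A"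
      by (auto elim!: set_times_elim)
    show "w \<in> C * X * A \<union> ((\<lambda>y. c * y) ` (X * A) - (\<lambda>y. c * y) ` (Z * A))"
    proof (cases "w \<in> C * X * A")
      case False
      with w have kc: "k = c" by auto
      have "w \<notin> (\<lambda>y. c * y) ` (Z * A)"
        using False by (auto simp: Z_def elim!: set_times_elim) (metis image_subset_iff mult.assoc)
      moreover have "w \<in> (\<lambda>y. c * y) ` (X * A)"
        using w kc by (auto simp: mult.assoc)
      ultimately show ?thesis by auto
    qed simp
  qed
  then have "card (insert c C * X * A)
      \<le> card (C * X * A \<union> ((\<lambda>y. c * y) ` (X * A) - (\<lambda>y. c * y) ` (Z * A)))"
    using fins by (intro card_mono) auto
  also have "\<dots> \<le> card (C * X * A) + card ((\<lambda>y. c * y) ` (X * A) - (\<lambda>y. c * y) ` (Z * A))"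
    by (rule card_Un_le)
  also have "card ((\<lambda>y. c * y) ` (X * A) - (\<lambda>y. c * y) ` (Z * A)) = card (X * A) - card (Z * A)"
  proof (subst card_Diff_subset)
    show "(\<lambda>y. c * y) ` (Z * A) \<subseteq> (\<lambda>y. c * y) ` (X * A)"
      using finZ by (intro image_mono set_times_mono2) auto
  qed (use fins card_c in auto)
  finally have 1: "card (insert c C * X * A) \<le> card (C * X * A) + (card (X * A) - card (Z * A))" .
  have "C * X \<union> (\<lambda>y. c * y) ` (X - Z) \<subseteq> insert c C * X"
    by (auto elim!: set_times_elim)
  then have "card (C * X \<union> (\<lambda>y. c * y) ` (X - Z)) \<le> card (insert c C * X)"
    using fin insert by (intro card_mono finite_set_times) auto
  moreover have "(C * X) \<inter> (\<lambda>y. c * y) ` (X - Z) = {}"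
    by (auto simp: Z_def)
  then have "card (C * X \<union> (\<lambda>y. c * y) ` (X - Z)) = card (C * X) + (card X - card Z)"
    using fins fin finZ card_c by (simp add: card_Un_disjoint card_Diff_subset)
  ultimately have 2: "card (C * X) + (card X - card Z) \<le> card (insert c C * X)" by simp
  have "card (insert c C * X * A) * card X \<le> (card (C * X * A) + (card (X * A) - card (Z * A))) * card X"
    using 1 by (rule mult_le_mono1)
  also have "\<dots> = card (C * X * A) * card X + (card (X * A) * card X - card (Z * A) * card X)"
    by (simp add: add_mult_distrib diff_mult_distrib)
  also have "\<dots> \<le> card (X * A) * card (C * X) + (card (X * A) * card X - card (X * A) * card Z)"
    using insert min[OF finZ(2)] by (intro add_mono diff_le_mono2) auto
  also have "\<dots> = card (X * A) * (card (C * X) + (card X - card Z))"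
    by (simp add: add_mult_distrib2 diff_mult_distrib2)
  also have "\<dots> \<le> card (X * A) * card (insert c C * X)"
    using 2 by (rule mult_le_mono2)
  finally show ?case .
qed

text \<open>Take a nonempty \<open>X \<subseteq> A\<close> minimising \<open>|XA| / |X|\<close>;
  comparison with \<open>A\<close> itself bounds this ratio by \<open>K\<close>. Iterating
  \<open>petridis\<close> with \<open>C = A ^ k\<close> bounds \<open>A ^ k * X\<close>, which
  contains a dilate of \<open>A ^ k\<close>.\<close>

lemma pluennecke:
  fixes A :: "real set"
  assumes fin: "finite A" and A: "A \<noteq> {}" "0 \<notin> A" and K: "real (card (A * A)) \<le> K * real (card A)"
  shows "real (card (A ^ k)) \<le> K ^ k * real (card A)"
proof -
  let ?f = "\<lambda>X. real (card (X * A)) / real (card X)"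
  have "\<exists>X. is_arg_min ?f (\<lambda>X. X \<in> Pow A - {{}}) X"
    using fin A by (intro ex_is_arg_min_if_finite) auto
  then obtain X where X: "X \<subseteq> A" "X \<noteq> {}"
    and X_min: "\<And>Z. Z \<subseteq> A \<Longrightarrow> Z \<noteq> {} \<Longrightarrow> ?f X \<le> ?f Z"
    by (auto simp: is_arg_min_linorder)
  have finX: "finite X" using X fin finite_subset by auto
  have cX: "card X > 0" and cA: "card A > 0" using finX X fin A by (auto simp: card_gt_0_iff)
  have min: "card (X * A) * card Z \<le> card (Z * A) * card X" if "Z \<subseteq> X" for Z
  proof (cases "Z = {}")
    case False
    then have "card Z > 0" using that finX finite_subset by (auto simp: card_gt_0_iff)
    then have "real (card (X * A)) * real (card Z) \<le> real (card (Z * A)) * real (card X)"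
      using X_min[of Z] that X False cX by (simp add: field_simps)
    then show ?thesis by (simp only: of_nat_mult [symmetric] of_nat_le_iff)
  qed simp
  have "?f X \<le> ?f A" using X_min A by simp
  also have "\<dots> \<le> K" using K cA by (simp add: field_simps)
  finally have fK: "?f X \<le> K" .
  then have K0: "0 \<le> K" by (rule order_trans[rotated]) simp
  have XK: "real (card (A ^ k * X)) \<le> K ^ k * real (card X)" for k
  proof (induction k)
    case (Suc k)
    have "card (A ^ k * X * A) * card X \<le> card (X * A) * card (A ^ k * X)"
      by (rule petridis) (use finX fin min A in \<open>auto simp: finite_set_power zero_notin_set_power\<close>)
    then have "real (card (A ^ k * X * A)) * real (card X) \<le> real (card (X * A)) * real (card (A ^ k * X))"
      by (simp only: of_nat_mult [symmetric] of_nat_le_iff)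
    then have "real (card (A ^ k * X * A)) \<le> ?f X * real (card (A ^ k * X))"
      using cX by (simp add: field_simps)
    also have "\<dots> \<le> K * (K ^ k * real (card X))"
      using fK K0 Suc by (intro mult_mono) auto
    finally show ?case by (simp add: mult_ac)
  qed (simp only: power_0 mult_1_left order_refl)
  obtain x where "x \<in> X" "x \<noteq> 0" using X A by auto
  then have "card (A ^ k) \<le> card (A ^ k * X)"
    using fin finX by (intro card_le_card_set_times) (auto simp: finite_set_power)
  then have "real (card (A ^ k)) \<le> K ^ k * real (card X)" using XK[of k] by linarith
  also have "\<dots> \<le> K ^ k * real (card A)"
    using X fin K0 by (intro mult_left_mono) (auto intro: card_mono)
  finally show ?thesis .
qed

section \<open>Lower bound for the energy\<close>

text \<open>Cauchy--Schwarz over the values of \<open>f\<close>, since the squared fibre sizes add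
  up to the number of collisions. With \<open>g = 1\<close> it bounds the number of values from
  below; with a general weight it serves in the triangle sum.\<close>

lemma sum_squared_le_collisions:
  fixes g :: "'b \<Rightarrow> real"
  assumes fin: "finite T"
  shows "(\<Sum>s\<in>T. g (f s)) ^ 2
    \<le> real (card {(s, s'). s \<in> T \<and> s' \<in> T \<and> f s = f s'}) * (\<Sum>i\<in>f ` T. g i ^ 2)"
proof -
  define F where "F i = {s \<in> T. f s = i}" for i
  have finF: "finite (F i)" for i using fin by (simp add: F_def)
  have "(\<Sum>s\<in>T. g (f s)) = (\<Sum>i\<in>f ` T. \<Sum>s\<in>F i. g (f s))"
    unfolding F_def by (rule sum.image_gen[OF fin])
  also have "\<dots> = (\<Sum>i\<in>f ` T. real (card (F i)) * g i)"
    by (intro sum.cong refl) (simp add: F_def)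
  finally have "(\<Sum>s\<in>T. g (f s)) ^ 2 \<le> (\<Sum>i\<in>f ` T. real (card (F i)) ^ 2) * (\<Sum>i\<in>f ` T. g i ^ 2)"
    by (simp only: Cauchy_Schwarz_ineq_sum)
  also have "(\<Sum>i\<in>f ` T. real (card (F i)) ^ 2) = real (\<Sum>i\<in>f ` T. card (F i \<times> F i))"
    by (simp add: card_cartesian_product power2_eq_square)
  also have "(\<Sum>i\<in>f ` T. card (F i \<times> F i)) = card (\<Union>i\<in>f ` T. F i \<times> F i)"
    using fin finF by (subst card_UN_disjoint) (auto simp: F_def)
  also have "(\<Union>i\<in>f ` T. F i \<times> F i) = {(s, s'). s \<in> T \<and> s' \<in> T \<and> f s = f s'}"
    by (auto simp: F_def)
  finally show ?thesis .
qed

text \<open>The sum counts ordered triples of points of the grid \<open>P \<times> P\<close> on a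
  common line of \<open>L\<close>, repetitions allowed. Two points determine a line, so
  \<open>L\<close> is finite.\<close>

lemma sum_line_cubes_le:
  fixes P :: "real set"
  assumes fin: "finite P"
  defines "L \<equiv> {(c, d). c \<noteq> 0 \<and> 2 \<le> card {x \<in> P. c * x + d \<in> P}}"
  shows "finite L"
    and "(\<Sum>(c, d)\<in>L. real (card {x \<in> P. c * x + d \<in> P}) ^ 3)
      \<le> 300 * real (card P) ^ 4 * (\<Sum>t=1..card P. 1 / real t)"
proof -
  let ?line = "\<lambda>(x, y, x', y'). ((y' - y) / (x' - x), y - (y' - y) / (x' - x) * x)"
  have "L \<subseteq> ?line ` (P \<times> P \<times> P \<times> P)"
  proof
    fix l assume "l \<in> L"
    then obtain c d where l: "l = (c, d)" and "2 \<le> card {x \<in> P. c * x + d \<in> P}"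
      by (auto simp: L_def)
    obtain D where "D \<subseteq> {x \<in> P. c * x + d \<in> P}" "card D = 2"
      using \<open>2 \<le> card _\<close> by (elim obtain_subset_with_card_n)
    then obtain x x' where "x \<in> P" "x' \<in> P" "c * x + d \<in> P" "c * x' + d \<in> P" "x \<noteq> x'"
      by (auto simp: card_2_iff)
    moreover have slope: "((c * x' + d) - (c * x + d)) / (x' - x) = c"
      using \<open>x \<noteq> x'\<close> by (simp add: field_simps)
    have "l = ?line (x, c * x + d, x', c * x' + d)"
      unfolding prod.case slope by (simp add: l)
    ultimately show "l \<in> ?line ` (P \<times> P \<times> P \<times> P)"
      by (intro image_eqI[of _ _ "(x, c * x + d, x', c * x' + d)"]) auto
  qed
  then show finL: "finite L" using fin by (meson finite_SigmaI finite_imageI finite_subset)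
  define f where "f = (\<lambda>(c, d). card {x \<in> P. c * x + d \<in> P})"
  have "(\<Sum>l\<in>L. real (f l) ^ 3) \<le> 3 * (100 * real (card P) ^ 4) * (\<Sum>t=1..card P. 1 / real t)"
  proof (rule sum_cube_le_if_card_ge_le[OF finL])
    show "f l \<le> card P" if "l \<in> L" for l
      using fin by (auto simp: f_def split: prod.splits intro: card_mono)
    show "real (card {l \<in> L. t \<le> f l}) * real t ^ 3 \<le> 100 * real (card P) ^ 4" if "1 \<le> t" for t
    proof -
      let ?L = "{l \<in> L. t \<le> f l}"
      \<comment> \<open>Every line of \<open>L\<close> already has two points, so the level
        \<open>t = 1\<close> coincides with the level 2, where \<open>rich_lines_bound\<close>
        applies.\<close>
      have "real (card ?L) * real (max 2 t) ^ 3 \<le> 100 * real (card P) ^ 2 * real (card P) ^ 2"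
        by (rule rich_lines_bound) (use fin finL in \<open>auto simp: L_def f_def\<close>)
      moreover have "real (card ?L) * real t ^ 3 \<le> real (card ?L) * real (max 2 t) ^ 3"
        by (intro mult_left_mono power_mono) auto
      ultimately show ?thesis by (simp add: power_add [symmetric] mult.assoc)
    qed
  qed
  then show "(\<Sum>(c, d)\<in>L. real (card {x \<in> P. c * x + d \<in> P}) ^ 3)
      \<le> 300 * real (card P) ^ 4 * (\<Sum>t=1..card P. 1 / real t)"
    by (simp add: f_def case_prod_unfold)
qed

lemma card_equal_ratios_le:
  fixes B :: "real set"
  assumes fin: "finite B"
  defines "ratio \<equiv> \<lambda>(x, y, y'). (x + y) / (x + y')"
  assumes T: "T \<subseteq> {(x, y, y'). x \<in> B \<and> y \<in> B \<and> y' \<in> B \<and> x + y \<noteq> 0 \<and> x + y' \<noteq> 0}"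
  shows "real (card {(s, s'). s \<in> T \<and> s' \<in> T \<and> ratio s = ratio s'})
    \<le> real (card B) ^ 4 * (1 + 4800 * (\<Sum>t=1..2 * card B. 1 / real t))"
proof -
  define P where "P = B \<union> uminus ` B"
  define L where "L = {(c, d). c \<noteq> 0 \<and> 2 \<le> card {x \<in> P. c * x + d \<in> P}}"
  define S where "S = (\<lambda>(c, d). {x \<in> P. c * x + d \<in> P})"
  have finP: "finite P" using fin by (simp add: P_def)
  have finS: "finite (S l)" for l using finP by (auto simp: S_def split: prod.splits)
  have cardP: "card P \<le> 2 * card B"
    unfolding P_def using card_Un_le[of B "uminus ` B"] card_image_le[OF fin, of uminus] by linarith
  have finL: "finite L" unfolding L_def by (rule sum_line_cubes_le[OF finP])
  let ?Q = "{(s, s'). s \<in> T \<and> s' \<in> T \<and> ratio s = ratio s'}"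
  define Q1 where "Q1 = {q \<in> ?Q. fst (snd (fst q)) = snd (snd (fst q))}"
  define Q2 where "Q2 = {q \<in> ?Q. fst (snd (fst q)) \<noteq> snd (snd (fst q))}"
  have split: "?Q = Q1 \<union> Q2" by (auto simp: Q1_def Q2_def)
  \<comment> \<open>For \<open>y = y'\<close> the ratio is 1, which forces \<open>v = v'\<close>;
    such solutions are determined by \<open>(x, y, u, v)\<close>, giving the term
    \<open>card B ^ 4\<close>.\<close>
  have diag: "v = v'" if "((x, y, y), (u, v, v')) \<in> ?Q" for x y u v v'
    using that T by (auto simp: ratio_def field_simps)
  let ?h = "\<lambda>((x, y, y'), (u, v, v')). (x, y, u, v)"
  have "card Q1 \<le> card (B \<times> B \<times> B \<times> B)"
  proof (rule card_inj_on_le[of ?h])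
    show "inj_on ?h Q1"
    proof (rule inj_onI)
      fix q q'
      assume q: "q \<in> Q1" "q' \<in> Q1" "?h q = ?h q'"
      obtain x y y' u v v' where 1: "q = ((x, y, y'), (u, v, v'))" by (metis prod_cases3 surj_pair)
      obtain x2 y2 y2' u2 v2 v2' where 2: "q' = ((x2, y2, y2'), (u2, v2, v2'))"
        by (metis prod_cases3 surj_pair)
      have y: "y' = y" "y2' = y2" using q(1,2) by (simp_all add: 1 2 Q1_def)
      have "v' = v" "v2' = v2"
        using q(1,2) diag[of x y u v v'] diag[of x2 y2 u2 v2 v2'] by (simp_all add: 1 2 y Q1_def)
      then show "q = q'" using q(3) by (simp add: 1 2 y)
    qed
    show "?h ` Q1 \<subseteq> B \<times> B \<times> B \<times> B"
      using T by (auto simp: Q1_def)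
  qed (use fin in simp)
  then have Q1: "card Q1 \<le> card B ^ 4" by (simp add: card_cartesian_product power4_eq_xxxx mult.assoc)
  let ?slope = "\<lambda>y y' v v'. (v - v') / (y - y' :: real)"
  \<comment> \<open>The slope is nonzero because \<open>u + v \<noteq> 0\<close>, so the line is not
    horizontal and can belong to \<open>L\<close>.\<close>
  have line: "v - v' \<noteq> 0 \<and> ?slope y y' v v' * (x + y) = u + v \<and> ?slope y y' v v' * (y - y') = v - v'"
    if "((x, y, y'), (u, v, v')) \<in> ?Q" "y \<noteq> y'" for x y y' u v v'
  proof -
    have nz: "x + y \<noteq> 0" "x + y' \<noteq> 0" "u + v \<noteq> 0" "u + v' \<noteq> 0" using that T by auto
    have eq: "(x + y) * (u + v') = (x + y') * (u + v)"
      using that(1) nz by (simp add: ratio_def frac_eq_eq mult.commute)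
    have e2: "(u + v) * (y - y') = (x + y) * (v - v')" using eq by (simp add: algebra_simps)
    then have "v - v' \<noteq> 0" using nz that by auto
    then show ?thesis using e2 that by (simp add: field_simps)
  qed
  have "card Q2 \<le> card (SIGMA l : L. S l \<times> S l \<times> S l)"
  proof (rule card_inj_on_le)
    \<comment> \<open>Record the line and the abscissas \<open>y\<close>, \<open>y'\<close>,
      \<open>- x\<close> of the three points. The line gives back the ordinates \<open>v\<close>,
      \<open>v'\<close>, \<open>- u\<close>, so nothing is lost.\<close>
    let ?g = "\<lambda>((x, y, y'), (u, v, v')).
      ((?slope y y' v v', v - ?slope y y' v v' * y), (y, y', - x))"
    show "?g ` Q2 \<subseteq> (SIGMA l : L. S l \<times> S l \<times> S l)"
    proof (rule image_subsetI)
      fix q assume q0: "q \<in> Q2"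
      obtain x y y' u v v' where qe: "q = ((x, y, y'), (u, v, v'))" by (metis prod_cases3 surj_pair)
      have q: "((x, y, y'), (u, v, v')) \<in> ?Q" "y \<noteq> y'" using q0 by (simp_all add: qe Q2_def)
      define c where "c = ?slope y y' v v'"
      define d where "d = v - c * y"
      have c: "c \<noteq> 0" "c * y + d = v" "c * y' + d = v'" "c * (- x) + d = - u"
        using line[OF q] q(2) by (auto simp: c_def [symmetric] d_def algebra_simps)
      have P: "x \<in> B" "y \<in> B" "y' \<in> B" "u \<in> B" "v \<in> B" "v' \<in> B" using q T by auto
      have SS: "y \<in> S (c, d)" "y' \<in> S (c, d)" "- x \<in> S (c, d)"
        using c P unfolding S_def P_def by auto
      have "card {y, y'} \<le> card (S (c, d))" using SS finS by (intro card_mono) auto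
      then have "(c, d) \<in> L" using c q by (auto simp: L_def S_def)
      then show "?g q \<in> (SIGMA l : L. S l \<times> S l \<times> S l)"
        using SS by (simp add: qe c_def d_def)
    qed
    show "inj_on ?g Q2"
    proof (rule inj_onI)
      fix q q' assume q: "q \<in> Q2" "q' \<in> Q2" "?g q = ?g q'"
      obtain x y y' u v v' where 1: "q = ((x, y, y'), (u, v, v'))" by (metis prod_cases3 surj_pair)
      obtain x2 y2 y2' u2 v2 v2' where 2: "q' = ((x2, y2, y2'), (u2, v2, v2'))" by (metis prod_cases3 surj_pair)
      have eq: "x2 = x" "y2 = y" "y2' = y'" using q(3) by (auto simp: 1 2)
      have e: "?slope y y' v v' = ?slope y y' v2 v2'"
        "v - ?slope y y' v v' * y = v2 - ?slope y y' v2 v2' * y"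
        using q(3) by (auto simp: 1 2 eq)
      have v: "v = v2" using e(2) unfolding e(1) by linarith
      have l: "((x, y, y'), (u, v, v')) \<in> ?Q" "((x, y, y'), (u2, v2, v2')) \<in> ?Q" "y \<noteq> y'"
        using q by (auto simp: Q2_def 1 2 eq)
      obtain k where k: "k = ?slope y y' v v'" "k = ?slope y y' v2 v2'" using e(1) by simp
      have s: "k * (x + y) = u + v" "k * (y - y') = v - v'"
        using line[OF l(1,3)] unfolding k(1) by blast+
      have s2: "k * (x + y) = u2 + v2" "k * (y - y') = v2 - v2'"
        using line[OF l(2,3)] unfolding k(2) by blast+
      have "v' = v2'" using s(2) s2(2) v by linarith
      moreover have "u = u2" using s(1) s2(1) v by linarith
      ultimately show "q = q'" by (simp add: 1 2 eq v)
    qed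
    show "finite (SIGMA l : L. S l \<times> S l \<times> S l)" using finL finS by auto
  qed
  then have "real (card Q2) \<le> real (card (SIGMA l : L. S l \<times> S l \<times> S l))" by simp
  also have "\<dots> = (\<Sum>(c, d)\<in>L. real (card {x \<in> P. c * x + d \<in> P}) ^ 3)"
    using finL finS by (auto simp: card_cartesian_product S_def case_prod_unfold power3_eq_cube mult.assoc intro!: sum.cong)
  also have "\<dots> \<le> 300 * real (card P) ^ 4 * (\<Sum>t=1..card P. 1 / real t)"
    unfolding L_def by (rule sum_line_cubes_le[OF finP])
  also have "\<dots> \<le> 300 * real (2 * card B) ^ 4 * (\<Sum>t=1..2 * card B. 1 / real t)"
    using cardP by (intro mult_mono power_mono sum_mono2) (auto intro: sum_nonneg)
  finally have Q2: "real (card Q2) \<le> real (card B) ^ 4 * (4800 * (\<Sum>t=1..2 * card B. 1 / real t))"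
    by (simp add: mult_ac)
  have "card ?Q \<le> card Q1 + card Q2" unfolding split by (rule card_Un_le)
  then have "real (card ?Q) \<le> real (card Q1) + real (card Q2)" by linarith
  moreover have "real (card Q1) \<le> real (card B) ^ 4"
    using Q1 by (metis of_nat_le_iff of_nat_power)
  ultimately show ?thesis using Q2 by (simp only: distrib_left mult_1_right)
qed

section \<open>Representation counts, additive energy, and its lower bound\<close>

definition rep :: "real set \<Rightarrow> real \<Rightarrow> nat" where
  "rep V d = card {x \<in> V. x + d \<in> V}"

text \<open>This counts quadruples in \<open>V\<close> with equal differences. Summing over pairs
  instead of over differences presents it as the sum of the entries of the matrix
  \<open>rep V (a - a')\<close>.\<close>

definition energy :: "real set \<Rightarrow> real" where
  "energy V = (\<Sum>a\<in>V. \<Sum>a'\<in>V. real (rep V (a - a')))"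

text \<open>Up to constants and \<open>h\<close>, there are \<open>n ^ 4 / M ^ 6\<close> ratios.
  Each of them, with each of the \<open>n\<close> dilations by \<open>A\<close>, gives its own pair
  in \<open>V \<times> V\<close> whose difference has at least \<open>\<Delta>\<close>, about
  \<open>n ^ 2 / M ^ 3\<close>, representations; the product of the three is
  \<open>n ^ 7 / M ^ 9\<close>.\<close>

lemma energy_product_set_ge:
  fixes A B :: "real set"
  assumes finA: "finite A" and finB: "finite B" and A: "A \<noteq> {}" "0 \<notin> A" and basis: "A \<subseteq> B + B"
    and h: "1 \<le> h" "(\<Sum>t=1..2 * card B. 1 / real t) \<le> h"
  shows "real (card A) ^ 7 \<le> 38408 * real (card B) ^ 9 * h * energy (A * A)"
proof -
  define V where "V = A * A"
  have finV: "finite V" using finA by (simp add: V_def finite_set_times)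
  define n where "n = real (card A)"
  define M where "M = real (card B)"
  have n: "n > 0" using A finA by (simp add: n_def card_gt_0_iff)
  have "B \<noteq> {}" using A basis by (auto simp: set_plus_def)
  then have M: "M > 0" using finB by (simp add: M_def card_gt_0_iff)
  define nb where "nb x = {y \<in> B. x + y \<in> A}" for x
  define cn where "cn = (\<lambda>(y, y'). {x \<in> B. x + y \<in> A \<and> x + y' \<in> A})"
  have fin_nb: "finite (nb x)" for x using finB by (simp add: nb_def)
  have fin_cn: "finite (cn p)" for p using finB by (simp add: cn_def split: prod.splits)
  \<comment> \<open>Half of the lower bound \<open>n ^ 2 / M ^ 3\<close> for the average number of
    common neighbours over the \<open>M ^ 2\<close> pairs \<open>(y, y')\<close>. Discarding pairs
    below this threshold therefore costs at most half of that bound for \<open>T0\<close>.\<close>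
  define \<Delta> where "\<Delta> = n ^ 2 / (2 * M ^ 3)"
  have \<Delta>: "\<Delta> > 0" using n M by (simp add: \<Delta>_def)
  define T0 where "T0 = (SIGMA x : B. nb x \<times> nb x)"
  define T where "T = {(x, y, y'). (x, y, y') \<in> T0 \<and> \<Delta> \<le> card (cn (y, y'))}"
  have finT0: "finite T0" using finB fin_nb by (auto simp: T0_def)
  have "T \<subseteq> T0" by (auto simp: T_def)
  then have finT: "finite T" using finT0 finite_subset by auto

  \<comment> \<open>Join \<open>x\<close> to \<open>y\<close> when \<open>x + y \<in> A\<close>.
    This gives at least \<open>n\<close> incidences, hence by Cauchy--Schwarz at least
    \<open>n ^ 2 / M\<close> triples \<open>(x, y, y')\<close> in \<open>T0\<close>.\<close>
  have "A \<subseteq> (\<lambda>(x, y). x + y) ` (SIGMA x : B. nb x)"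
    using basis by (force simp: set_plus_def nb_def)
  then have "card A \<le> card (SIGMA x : B. nb x)"
    using finB fin_nb by (intro surj_card_le) auto
  also have "\<dots> = (\<Sum>x\<in>B. card (nb x))" using finB fin_nb by simp
  finally have "n \<le> (\<Sum>x\<in>B. real (card (nb x)))"
    unfolding n_def by (simp only: of_nat_sum [symmetric] of_nat_le_iff)
  then have "n ^ 2 \<le> (\<Sum>x\<in>B. real (card (nb x))) ^ 2" using n by (intro power_mono) auto
  also have "\<dots> \<le> (\<Sum>x\<in>B. real (card (nb x)) ^ 2) * M"
    unfolding M_def by (rule sum_squared_le_sum_of_squares)
  also have "(\<Sum>x\<in>B. real (card (nb x)) ^ 2) = real (card T0)"
    using finB fin_nb by (simp add: T0_def card_cartesian_product power2_eq_square)
  finally have T0: "n ^ 2 / M \<le> card T0" using M by (simp add: field_simps)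

  have "card (T0 - T) \<le> card (SIGMA p : {p \<in> B \<times> B. card (cn p) < \<Delta>}. cn p)"
  proof (rule card_inj_on_le[of "\<lambda>(x, y, y'). ((y, y'), x)"])
    show "(\<lambda>(x, y, y'). ((y, y'), x)) ` (T0 - T) \<subseteq> (SIGMA p : {p \<in> B \<times> B. card (cn p) < \<Delta>}. cn p)"
      by (auto simp: T0_def T_def nb_def cn_def)
    show "finite (SIGMA p : {p \<in> B \<times> B. card (cn p) < \<Delta>}. cn p)"
      using finB fin_cn by (intro finite_SigmaI) auto
  qed (auto intro: inj_onI)
  also have "\<dots> = (\<Sum>p | p \<in> B \<times> B \<and> card (cn p) < \<Delta>. card (cn p))"
    using finB fin_cn by simp
  finally have "real (card (T0 - T)) \<le> (\<Sum>p | p \<in> B \<times> B \<and> card (cn p) < \<Delta>. real (card (cn p)))"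
    by (simp only: of_nat_sum [symmetric] of_nat_le_iff)
  also have "\<dots> \<le> (\<Sum>p | p \<in> B \<times> B \<and> card (cn p) < \<Delta>. \<Delta>)"
    by (intro sum_mono) auto
  also have "\<dots> \<le> (\<Sum>p\<in>B \<times> B. \<Delta>)"
    using finB \<Delta> by (intro sum_mono2) auto
  also have "\<dots> = M ^ 2 * \<Delta>" by (simp add: M_def card_cartesian_product power2_eq_square)
  also have "\<dots> = n ^ 2 / (2 * M)" using M by (simp add: \<Delta>_def power2_eq_square power3_eq_cube)
  finally have "real (card (T0 - T)) \<le> n ^ 2 / (2 * M)" .
  moreover have "real (card (T0 - T)) = real (card T0) - real (card T)"
    using \<open>T \<subseteq> T0\<close> finT finT0 by (simp add: card_Diff_subset card_mono of_nat_diff)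
  moreover have "n ^ 2 / M = n ^ 2 / (2 * M) + n ^ 2 / (2 * M)" by simp
  ultimately have cardT: "n ^ 2 / (2 * M) \<le> card T" using T0 by linarith

  define ratio where "ratio = (\<lambda>(x, y, y'). (x + y) / (x + y' :: real))"
  define R where "R = ratio ` T"
  have T_B: "T \<subseteq> {(x, y, y'). x \<in> B \<and> y \<in> B \<and> y' \<in> B \<and> x + y \<noteq> 0 \<and> x + y' \<noteq> 0}"
    using A by (auto simp: T_def T0_def nb_def)
  have "(n ^ 2 / (2 * M)) ^ 2 \<le> real (card T) ^ 2" using cardT n M by (intro power_mono) auto
  also have "\<dots> \<le> real (card R) * real (card {(s, s'). s \<in> T \<and> s' \<in> T \<and> ratio s = ratio s'})"
    using sum_squared_le_collisions[OF finT, of "\<lambda>_. 1" ratio] by (simp add: R_def mult.commute)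
  also have "\<dots> \<le> real (card R) * (M ^ 4 * (1 + 4800 * (\<Sum>t=1..2 * card B. 1 / real t)))"
    unfolding M_def ratio_def by (intro mult_left_mono card_equal_ratios_le[OF finB T_B]) auto
  also have "\<dots> \<le> real (card R) * (M ^ 4 * (4801 * h))"
    using h by (intro mult_left_mono) auto
  finally have R: "n ^ 4 \<le> real (card R) * (19204 * M ^ 6 * h)"
    using M by (simp add: field_simps power2_eq_square eval_nat_numeral)

  define pick where "pick r = (SOME s. s \<in> T \<and> ratio s = r)" for r
  have pick: "pick r \<in> T \<and> ratio (pick r) = r" if "r \<in> R" for r
  proof -
    from that obtain s where "s \<in> T \<and> ratio s = r" by (auto simp: R_def)
    then show ?thesis unfolding pick_def by (rule someI)
  qed
  \<comment> \<open>With one triple fixed per ratio, the pair determines \<open>(c, r)\<close>: the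
    quotient of its coordinates is \<open>r\<close>, and then the second coordinate gives
    \<open>c\<close>.\<close>
  define \<phi> where "\<phi> = (\<lambda>(c :: real, r). case pick r of (x, y, y') \<Rightarrow> (c * (x + y), c * (x + y')))"
  have inj: "inj_on \<phi> (A \<times> R)"
  proof (rule inj_onI)
    fix z z' assume z: "z \<in> A \<times> R" "z' \<in> A \<times> R" "\<phi> z = \<phi> z'"
    obtain c r where 1: "z = (c, r)" by (cases z)
    obtain d r' where 2: "z' = (d, r')" by (cases z')
    obtain x y y' where p1: "pick r = (x, y, y')" by (cases "pick r")
    obtain u v v' where p2: "pick r' = (u, v, v')" by (cases "pick r'")
    have cd: "c \<noteq> 0" "d \<noteq> 0" using z A by (auto simp: 1 2)
    have nz: "x + y' \<noteq> 0"
      using pick[of r] z T_B by (auto simp: 1 p1)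
    have r: "r = (x + y) / (x + y')" "r' = (u + v) / (u + v')"
      using pick[of r] pick[of r'] z by (auto simp: 1 2 p1 p2 ratio_def)
    have e: "c * (x + y) = d * (u + v)" "c * (x + y') = d * (u + v')"
      using z(3) by (auto simp: \<phi>_def 1 2 p1 p2)
    have "r = (c * (x + y)) / (c * (x + y'))" using cd by (simp add: r)
    also have "\<dots> = r'" unfolding e using cd by (simp add: r)
    finally have "r = r'" .
    moreover from this p1 p2 have "u = x" "v' = y'" by auto
    then have "c = d" using e(2) nz by simp
    ultimately show "z = z'" by (simp add: 1 2)
  qed
  have img: "p \<in> V \<times> V \<and> \<Delta> \<le> real (rep V (fst p - snd p))" if p: "p \<in> \<phi> ` (A \<times> R)" for p
  proof -
    from p obtain c r where cr: "c \<in> A" "r \<in> R" "p = \<phi> (c, r)" by auto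
    obtain x y y' where p1: "pick r = (x, y, y')" by (cases "pick r")
    have pe: "p = (c * (x + y), c * (x + y'))" by (simp add: cr \<phi>_def p1)
    have "(x, y, y') \<in> T" using pick[OF cr(2)] p1 by simp
    then have xy: "x + y \<in> A" "x + y' \<in> A" "\<Delta> \<le> card (cn (y, y'))"
      by (auto simp: T_def T0_def nb_def)
    \<comment> \<open>Each common neighbour \<open>x\<close> represents the same difference as
      \<open>c * (x + y) - c * (x + y')\<close>.\<close>
    have "card (cn (y, y')) \<le> rep V (c * y - c * y')"
      unfolding rep_def
    proof (rule card_inj_on_le[of "\<lambda>x. c * (x + y')"])
      show "inj_on (\<lambda>x. c * (x + y')) (cn (y, y'))"
        using cr A by (auto intro: inj_onI)
      show "(\<lambda>x. c * (x + y')) ` cn (y, y') \<subseteq> {x \<in> V. x + (c * y - c * y') \<in> V}"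
      proof (rule image_subsetI)
        fix x assume "x \<in> cn (y, y')"
        then have "c * (x + y) \<in> V" "c * (x + y') \<in> V"
          using cr(1) unfolding V_def by (auto simp: cn_def intro!: set_times_intro)
        moreover have "c * (x + y') + (c * y - c * y') = c * (x + y)" by (simp add: algebra_simps)
        ultimately show "c * (x + y') \<in> {x \<in> V. x + (c * y - c * y') \<in> V}" by simp
      qed
    qed (use finV in simp)
    moreover have "fst p - snd p = c * y - c * y'" by (simp add: pe algebra_simps)
    ultimately show ?thesis
      using xy cr(1) unfolding V_def by (auto simp: pe intro!: set_times_intro)
  qed
  have "card (\<phi> ` (A \<times> R)) = card A * card R"
    using card_image[OF inj] by (simp add: card_cartesian_product)
  then have "n * real (card R) * \<Delta> = (\<Sum>p\<in>\<phi> ` (A \<times> R). \<Delta>)" by (simp add: n_def)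
  also have "\<dots> \<le> (\<Sum>p\<in>\<phi> ` (A \<times> R). real (rep V (fst p - snd p)))"
    using img by (intro sum_mono) blast
  also have "\<dots> \<le> (\<Sum>p\<in>V \<times> V. real (rep V (fst p - snd p)))"
    using img finV by (intro sum_mono2) auto
  also have "\<dots> = energy V" by (simp add: energy_def sum.cartesian_product case_prod_unfold)
  finally have E: "n * real (card R) * \<Delta> \<le> energy V" .
  have "n ^ 7 = n ^ 4 * (2 * M ^ 3 * n * \<Delta>)"
    using M by (simp add: \<Delta>_def eval_nat_numeral)
  also have "\<dots> \<le> (real (card R) * (19204 * M ^ 6 * h)) * (2 * M ^ 3 * n * \<Delta>)"
    using R M n \<Delta> by (intro mult_right_mono) auto
  also have "\<dots> = 38408 * M ^ 9 * h * (n * real (card R) * \<Delta>)"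
    by (simp add: eval_nat_numeral mult_ac)
  also have "\<dots> \<le> 38408 * M ^ 9 * h * energy V"
    using E M h by (intro mult_left_mono) auto
  finally show ?thesis unfolding n_def M_def V_def .
qed

section \<open>Upper bound for the energy\<close>

text \<open>If \<open>x + d\<close> lies in \<open>Y\<close>, then \<open>c * x + c * d\<close> lies
  in \<open>A * Y\<close> for every \<open>c \<in> A\<close>. So one rich shift \<open>d\<close>
  produces \<open>card A\<close> different rich lines in the grid \<open>X \<times> (A * Y)\<close>,
  and this gains the factor \<open>card A\<close> over a direct use of
  \<open>rich_lines_bound\<close>.\<close>

lemma card_rich_shifts_le:
  fixes X Y A D :: "real set"
  assumes fin: "finite X" "finite Y" "finite A" "finite D" and "0 \<notin> A" "0 \<notin> Y" "t \<ge> 1"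
    and D: "\<And>d. d \<in> D \<Longrightarrow> t \<le> card {x \<in> X. x + d \<in> Y}"
  shows "real (card A) * real (card D) * real t ^ 3 \<le> 100 * real (card X) ^ 2 * real (card (A * Y)) ^ 2"
proof (cases "A = {} \<or> D = {}")
  case False
  have finAY: "finite (A * Y)" using fin by (simp add: finite_set_times)
  show ?thesis
  proof (cases "t = 1")
    case True
    \<comment> \<open>For \<open>t = 1\<close> there are no two points to fix a line, and trivial
      counting replaces Szemeredi--Trotter: \<open>D\<close> lies in \<open>Y - X\<close>, and
      \<open>A\<close> and \<open>Y\<close> both embed in \<open>A * Y\<close>.\<close>
    have XY: "\<exists>x \<in> X. x + d \<in> Y" if "d \<in> D" for d
    proof -
      have "{x \<in> X. x + d \<in> Y} \<noteq> {}" using D[OF that] True by fastforce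
      then show ?thesis by auto
    qed
    have "D \<subseteq> (\<lambda>(x, y). y - x) ` (X \<times> Y)"
    proof
      fix d assume "d \<in> D"
      then obtain x where "x \<in> X" "x + d \<in> Y" using XY by auto
      then show "d \<in> (\<lambda>(x, y). y - x) ` (X \<times> Y)" by (intro image_eqI[of _ _ "(x, x + d)"]) auto
    qed
    then have 1: "card D \<le> card X * card Y"
      using fin surj_card_le[of "X \<times> Y" D] by (simp add: card_cartesian_product)
    obtain d where "d \<in> D" using \<open>\<not> (A = {} \<or> D = {})\<close> by auto
    then obtain x where "x \<in> X" "x + d \<in> Y" using XY by auto
    then have y: "x + d \<in> Y" "x + d \<noteq> 0" using \<open>0 \<notin> Y\<close> by metis+
    have "X \<noteq> {}" using \<open>x \<in> X\<close> by auto
    then have X: "1 \<le> card X" using fin by (simp add: Suc_le_eq card_gt_0_iff)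
    have 2: "card A \<le> card (A * Y)" using fin y by (intro card_le_card_set_times)
    obtain a where "a \<in> A" "a \<noteq> 0" using \<open>\<not> (A = {} \<or> D = {})\<close> \<open>0 \<notin> A\<close> by fastforce
    then have 3: "card Y \<le> card (A * Y)"
      using card_le_card_set_times[of Y A a] fin by (simp add: mult.commute)
    have "card A * card D \<le> card (A * Y) * (card X * card (A * Y))"
      using 2 le_trans[OF 1 mult_le_mono2[OF 3]] by (rule mult_le_mono)
    also have "\<dots> \<le> card (A * Y) * (card X * card X * card (A * Y))"
      using X by (intro mult_le_mono2 mult_le_mono1) simp
    finally have "card A * card D \<le> 100 * card X ^ 2 * card (A * Y) ^ 2"
      by (simp add: power2_eq_square mult_ac)
    then have "real (card A * card D) \<le> real (100 * card X ^ 2 * card (A * Y) ^ 2)"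
      by (simp only: of_nat_le_iff)
    then show ?thesis using True by simp
  next
    case False
    let ?L = "(\<lambda>(c, d). (c, c * d)) ` (A \<times> D)"
    have "inj_on (\<lambda>(c, d). (c, c * d)) (A \<times> D)"
      using \<open>0 \<notin> A\<close> by (auto intro!: inj_onI)
    then have "card ?L = card A * card D" by (simp add: card_image card_cartesian_product)
    moreover have "real (card ?L) * real t ^ 3 \<le> 100 * real (card X) ^ 2 * real (card (A * Y)) ^ 2"
    proof (rule rich_lines_bound)
      fix c e assume "(c, e) \<in> ?L"
      then obtain d where d: "c \<in> A" "d \<in> D" "e = c * d" by auto
      have "card {x \<in> X. x + d \<in> Y} \<le> card {x \<in> X. c * x + e \<in> A * Y}"
      proof (rule card_mono)
        show "{x \<in> X. x + d \<in> Y} \<subseteq> {x \<in> X. c * x + e \<in> A * Y}"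
          using d by (auto simp: distrib_left [symmetric])
      qed (use fin in simp)
      then show "c \<noteq> 0 \<and> t \<le> card {x \<in> X. c * x + e \<in> A * Y}"
        using D[OF d(2)] d(1) \<open>0 \<notin> A\<close> by auto
    qed (use fin finAY False \<open>t \<ge> 1\<close> in auto)
    ultimately show ?thesis by simp
  qed
qed auto

text \<open>For the positive semidefinite matrix \<open>r\<close> this says that the trace of its
  cube is at least the cube of \<open>E / card I\<close>, its Rayleigh quotient at the all-ones
  vector. Two uses of Cauchy--Schwarz replace eigenvalues: \<open>E ^ 2 \<le> U * card I\<close> and
  \<open>U ^ 2 \<le> S * card I * E\<close>.\<close>

lemma gram_triangle_sum_ge:
  fixes X :: "'a \<Rightarrow> 'b \<Rightarrow> real" and Z
  assumes fin: "finite I"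
  defines "r \<equiv> \<lambda>a b. \<Sum>z\<in>Z. X a z * X b z"
  shows "(\<Sum>a\<in>I. \<Sum>b\<in>I. r a b) ^ 3 \<le> real (card I) ^ 3 * (\<Sum>a\<in>I. \<Sum>b\<in>I. \<Sum>c\<in>I. r a b * r b c * r a c)"
proof -
  define E where "E = (\<Sum>a\<in>I. \<Sum>b\<in>I. r a b)"
  define S where "S = (\<Sum>a\<in>I. \<Sum>b\<in>I. \<Sum>c\<in>I. r a b * r b c * r a c)"
  \<comment> \<open>In matrix terms \<open>v\<close> is the transpose of \<open>X\<close> applied to
    the all-ones vector, \<open>P\<close> is the product of \<open>r\<close> and \<open>X\<close>,
    and \<open>U\<close> is the squared norm of the row sums of \<open>r\<close>. The squared norm
    of \<open>P\<close> is the trace of the cube of \<open>r\<close>.\<close>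
  define v where "v z = (\<Sum>a\<in>I. X a z)" for z
  define P where "P a z = (\<Sum>b\<in>I. r a b * X b z)" for a z
  define U where "U = (\<Sum>b\<in>I. (\<Sum>a\<in>I. r a b) ^ 2)"
  have sym: "r a b = r b a" for a b by (simp add: r_def mult.commute)
  have row: "(\<Sum>b\<in>I. r a b) = (\<Sum>z\<in>Z. X a z * v z)" for a
    unfolding r_def v_def by (subst sum.swap) (simp add: sum_distrib_left)
  have E: "E = (\<Sum>z\<in>Z. v z ^ 2)"
    unfolding E_def row by (subst sum.swap) (simp add: v_def power2_eq_square sum_distrib_right)
  have PP: "(\<Sum>z\<in>Z. P a z ^ 2) = (\<Sum>b\<in>I. \<Sum>c\<in>I. r a b * r b c * r a c)" for a
  proof -
    have "(\<Sum>z\<in>Z. P a z ^ 2) = (\<Sum>z\<in>Z. \<Sum>b\<in>I. \<Sum>c\<in>I. (r a b * X b z) * (r a c * X c z))"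
      by (simp add: P_def power2_eq_square sum_product)
    also have "\<dots> = (\<Sum>b\<in>I. \<Sum>c\<in>I. \<Sum>z\<in>Z. (r a b * X b z) * (r a c * X c z))"
      by (subst sum.swap, intro sum.cong refl, rule sum.swap)
    also have "\<dots> = (\<Sum>b\<in>I. \<Sum>c\<in>I. r a b * r b c * r a c)"
    proof (intro sum.cong refl)
      fix b c
      have "(\<Sum>z\<in>Z. (r a b * X b z) * (r a c * X c z)) = r a b * r a c * (\<Sum>z\<in>Z. X b z * X c z)"
        by (simp add: sum_distrib_left mult_ac)
      also have "(\<Sum>z\<in>Z. X b z * X c z) = r b c" by (simp add: r_def)
      finally show "(\<Sum>z\<in>Z. (r a b * X b z) * (r a c * X c z)) = r a b * r b c * r a c"
        by (simp add: mult_ac)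
    qed
    finally show ?thesis .
  qed
  have Pv: "(\<Sum>a\<in>I. \<Sum>z\<in>Z. P a z * v z) = U"
  proof -
    have "(\<Sum>a\<in>I. \<Sum>z\<in>Z. P a z * v z) = (\<Sum>a\<in>I. \<Sum>z\<in>Z. \<Sum>b\<in>I. r a b * (X b z * v z))"
      by (simp add: P_def sum_distrib_right mult.assoc)
    also have "\<dots> = (\<Sum>a\<in>I. \<Sum>b\<in>I. \<Sum>z\<in>Z. r a b * (X b z * v z))"
      by (intro sum.cong refl) (rule sum.swap)
    also have "\<dots> = (\<Sum>a\<in>I. \<Sum>b\<in>I. r a b * (\<Sum>c\<in>I. r b c))"
      by (simp add: row sum_distrib_left)
    also have "\<dots> = (\<Sum>b\<in>I. (\<Sum>a\<in>I. r a b) * (\<Sum>c\<in>I. r b c))"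
      by (subst sum.swap) (simp add: sum_distrib_right)
    also have "\<dots> = U"
      unfolding U_def power2_eq_square by (intro sum.cong refl arg_cong2[where f = "(*)"] sym)
    finally show ?thesis .
  qed
  have "U ^ 2 = (\<Sum>p\<in>I \<times> Z. P (fst p) (snd p) * v (snd p)) ^ 2"
    by (simp add: Pv [symmetric] sum.cartesian_product case_prod_unfold)
  also have "\<dots> \<le> (\<Sum>p\<in>I \<times> Z. P (fst p) (snd p) ^ 2) * (\<Sum>p\<in>I \<times> Z. v (snd p) ^ 2)"
    by (rule Cauchy_Schwarz_ineq_sum)
  also have "(\<Sum>p\<in>I \<times> Z. P (fst p) (snd p) ^ 2) = (\<Sum>a\<in>I. \<Sum>z\<in>Z. P a z ^ 2)"
    by (simp add: sum.cartesian_product case_prod_unfold)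
  also have "\<dots> = S" by (simp add: PP S_def)
  also have "(\<Sum>p\<in>I \<times> Z. v (snd p) ^ 2) = (\<Sum>a\<in>I. \<Sum>z\<in>Z. v z ^ 2)"
    by (simp only: sum.cartesian_product case_prod_unfold)
  also have "\<dots> = real (card I) * E" by (simp add: E)
  finally have U: "U ^ 2 \<le> S * (real (card I) * E)" .
  have "E = (\<Sum>b\<in>I. \<Sum>a\<in>I. r a b)" unfolding E_def by (rule sum.swap)
  then have "E ^ 2 \<le> U * card I"
    using sum_squared_le_sum_of_squares[of "\<lambda>b. \<Sum>a\<in>I. r a b" I] by (simp add: U_def)
  then have "(E ^ 2) ^ 2 \<le> (U * card I) ^ 2" by (intro power_mono) auto
  also have "\<dots> = U ^ 2 * real (card I) ^ 2" by (simp add: power_mult_distrib)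
  also have "\<dots> \<le> (S * (real (card I) * E)) * real (card I) ^ 2" using U by (intro mult_right_mono) auto
  finally have "E * E ^ 3 \<le> E * (real (card I) ^ 3 * S)" by (simp add: eval_nat_numeral mult_ac)
  moreover have "E \<ge> 0" unfolding E by (simp add: sum_nonneg)
  moreover have "S \<ge> 0" unfolding S_def PP [symmetric] by (simp add: sum_nonneg)
  ultimately have "E ^ 3 \<le> real (card I) ^ 3 * S"
    by (cases "E = 0") auto
  then show ?thesis unfolding E_def S_def .
qed

text \<open>Pointwise, \<open>f x\<close> is at most \<open>s\<close> or at most
  \<open>f x ^ 3 / s ^ 2\<close>; the cut-off \<open>s\<close> is left free for later
  balancing.\<close>

lemma sum_le_by_cubes:
  fixes f :: "'a \<Rightarrow> real"
  assumes "\<And>x. x \<in> S \<Longrightarrow> 0 \<le> f x" "s > 0"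
  shows "sum f S \<le> s * real (card S) + (\<Sum>x\<in>S. f x ^ 3) / s ^ 2"
proof -
  have "f x \<le> s + f x ^ 3 / s ^ 2" if "x \<in> S" for x
  proof (cases "f x \<le> s")
    case True
    have "0 \<le> f x ^ 3 / s ^ 2" using assms that by simp
    with True show ?thesis by linarith
  next
    case False
    then have "f x * s ^ 2 \<le> f x * f x ^ 2" using assms by (intro mult_left_mono power_mono) auto
    then have "f x \<le> f x ^ 3 / s ^ 2" using assms by (simp add: field_simps eval_nat_numeral)
    then show ?thesis using assms by linarith
  qed
  then have "sum f S \<le> (\<Sum>x\<in>S. s + f x ^ 3 / s ^ 2)" by (rule sum_mono)
  then show ?thesis by (simp add: sum.distrib sum_divide_distrib mult.commute)
qed

text \<open>An \<open>x\<close> with many \<open>z\<close> is, up to sign, a rich shift from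
  \<open>D2\<close> to \<open>D3\<close>, so \<open>card_rich_shifts_le\<close> bounds the third
  moment of \<open>f\<close> over \<open>D1\<close>; \<open>sum_le_by_cubes\<close> passes to the
  first moment. The resulting bound is symmetric in the three thresholds.\<close>

lemma card_additive_triples_le:
  fixes A D1 D2 D3 :: "real set"
  assumes fin: "finite A" "finite D1" "finite D2" "finite D3" and A: "A \<noteq> {}" "0 \<notin> A" and "0 \<notin> D3"
    and \<kappa>: "\<kappa> > 0" and t: "t1 > 0" "t2 > 0" "t3 > 0"
    and D: "card D1 \<le> \<kappa> / t1 ^ 3" "card D2 \<le> \<kappa> / t2 ^ 3" "card (A * D3) \<le> \<kappa> / t3 ^ 3"
    and h: "0 < h" "(\<Sum>t=1..card D2. 1 / real t) \<le> h"
    and \<tau>: "\<tau> > 0" "\<tau> ^ 3 = h / card A"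
  shows "real (card {(x, z). x \<in> D1 \<and> z \<in> D2 \<and> z - x \<in> D3}) \<le> 301 * \<kappa> ^ 2 * \<tau> / (t1 * t2 * t3) ^ 2"
proof -
  define n where "n = real (card A)"
  have n: "n > 0" using fin A by (simp add: n_def card_gt_0_iff)
  define f where "f x = card {z \<in> D2. z - x \<in> D3}" for x
  define C where "C = 100 * \<kappa> ^ 4 / (n * (t2 * t3) ^ 6)"
  have "{(x, z). x \<in> D1 \<and> z \<in> D2 \<and> z - x \<in> D3} = (SIGMA x : D1. {z \<in> D2. z - x \<in> D3})" by auto
  then have count: "real (card {(x, z). x \<in> D1 \<and> z \<in> D2 \<and> z - x \<in> D3}) = (\<Sum>x\<in>D1. real (f x))"
    using fin by (simp add: f_def)
  have "real (card {x \<in> D1. t \<le> f x}) * real t ^ 3 \<le> C" if "1 \<le> t" for t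
  proof -
    let ?X = "uminus ` {x \<in> D1. t \<le> f x}"
    have "n * real (card ?X) * real t ^ 3 \<le> 100 * real (card D2) ^ 2 * real (card (A * D3)) ^ 2"
      unfolding n_def using fin A \<open>0 \<notin> D3\<close> that by (intro card_rich_shifts_le) (auto simp: f_def)
    also have "card ?X = card {x \<in> D1. t \<le> f x}" by (intro card_image) auto
    also have "100 * real (card D2) ^ 2 * real (card (A * D3)) ^ 2 \<le> 100 * (\<kappa> / t2 ^ 3) ^ 2 * (\<kappa> / t3 ^ 3) ^ 2"
      using D by (intro mult_mono power_mono) auto
    also have "\<dots> = n * C" using n t by (simp add: C_def field_simps eval_nat_numeral)
    finally show ?thesis using n by (simp add: mult.assoc)
  qed
  then have "(\<Sum>x\<in>D1. real (f x) ^ 3) \<le> 3 * C * (\<Sum>t=1..card D2. 1 / real t)"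
    using fin by (intro sum_cube_le_if_card_ge_le) (auto simp: f_def intro: card_mono)
  also have "\<dots> \<le> 3 * C * h" using h \<kappa> n t by (intro mult_left_mono) (auto simp: C_def)
  finally have cubes: "(\<Sum>x\<in>D1. real (f x) ^ 3) \<le> 3 * C * h" .
  \<comment> \<open>This cut-off gives both terms of \<open>sum_le_by_cubes\<close> the same shape,
    with coefficients 1 and 300. The equation \<open>h = n * \<tau> ^ 3\<close> is what makes them
    match.\<close>
  define s where "s = \<kappa> * \<tau> * t1 / (t2 * t3) ^ 2"
  have s: "s > 0" using \<kappa> \<tau> t by (simp add: s_def)
  have "(\<Sum>x\<in>D1. real (f x)) \<le> s * real (card D1) + (\<Sum>x\<in>D1. real (f x) ^ 3) / s ^ 2"
    by (rule sum_le_by_cubes) (use s in auto)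
  also have "\<dots> \<le> s * (\<kappa> / t1 ^ 3) + 3 * C * h / s ^ 2"
    using s D cubes by (intro add_mono mult_left_mono divide_right_mono) auto
  also have "s * (\<kappa> / t1 ^ 3) = \<kappa> ^ 2 * \<tau> / (t1 * t2 * t3) ^ 2"
    using t by (simp add: s_def field_simps eval_nat_numeral)
  also have "h = n * \<tau> ^ 3" using \<tau> n by (simp add: n_def)
  then have "3 * C * h / s ^ 2 = 300 * \<kappa> ^ 2 * \<tau> / (t1 * t2 * t3) ^ 2"
    using t n \<kappa> \<tau>(1) by (simp add: s_def C_def field_simps eval_nat_numeral)
  finally show ?thesis unfolding count by (simp add: field_simps)
qed

section \<open>The representation function and its Gram matrix\<close>

lemma rep_eq_card_pairs:
  assumes "finite V"
  shows "rep V d = card {p \<in> V \<times> V. fst p - snd p = d}"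
  unfolding rep_def
proof (rule bij_betw_same_card[of "\<lambda>x. (x + d, x)"])
  show "bij_betw (\<lambda>x. (x + d, x)) {x \<in> V. x + d \<in> V} {p \<in> V \<times> V. fst p - snd p = d}"
    by (rule bij_betw_byWitness[of _ snd]) auto
qed

lemma rep_uminus: "rep V (- d) = rep V d"
  unfolding rep_def
proof (rule bij_betw_same_card[of "\<lambda>x. x - d"])
  show "bij_betw (\<lambda>x. x - d) {x \<in> V. x + - d \<in> V} {x \<in> V. x + d \<in> V}"
    by (rule bij_betw_byWitness[of _ "\<lambda>x. x + d"]) auto
qed

lemma rep_le_card: "finite V \<Longrightarrow> rep V d \<le> card V"
  unfolding rep_def by (intro card_mono) auto

lemma sum_differences:
  fixes g :: "real \<Rightarrow> real"
  assumes fin: "finite V"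
  shows "(\<Sum>a\<in>V. \<Sum>a'\<in>V. g (a - a'))
    = (\<Sum>d\<in>(\<lambda>(a, a'). a - a') ` (V \<times> V). real (rep V d) * g d)"
proof -
  let ?f = "\<lambda>(a, a'). a - a' :: real"
  have "(\<Sum>a\<in>V. \<Sum>a'\<in>V. g (a - a')) = (\<Sum>p\<in>V \<times> V. g (?f p))"
    by (simp only: sum.cartesian_product case_prod_unfold)
  also have "\<dots> = (\<Sum>d\<in>?f ` (V \<times> V). \<Sum>p | p \<in> V \<times> V \<and> ?f p = d. g (?f p))"
    using fin by (intro sum.image_gen) simp
  also have "\<dots> = (\<Sum>d\<in>?f ` (V \<times> V). real (rep V d) * g d)"
  proof (intro sum.cong refl)
    fix d
    have "(\<Sum>p | p \<in> V \<times> V \<and> ?f p = d. g (?f p)) = (\<Sum>p | p \<in> V \<times> V \<and> ?f p = d. g d)"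
      by (intro sum.cong) auto
    then show "(\<Sum>p | p \<in> V \<times> V \<and> ?f p = d. g (?f p)) = real (rep V d) * g d"
      by (simp add: rep_eq_card_pairs[OF fin] case_prod_unfold)
  qed
  finally show ?thesis .
qed

text \<open>The numbers \<open>rep V (a - b)\<close> are the inner products of the indicator rows
  \<open>X a z\<close> of \<open>a + z \<in> V\<close>. For \<open>a \<in> V\<close> such a
  \<open>z\<close> is a difference of elements of \<open>V\<close>, so the finite range
  \<open>Z\<close> loses nothing.\<close>

lemma energy_cubed_le:
  assumes fin: "finite V"
  shows "energy V ^ 3 \<le> real (card V) ^ 3 *
    (\<Sum>a\<in>V. \<Sum>b\<in>V. \<Sum>c\<in>V. real (rep V (a - b)) * real (rep V (b - c)) * real (rep V (a - c)))"
proof -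
  define Z where "Z = (\<lambda>(a, a'). a - a') ` (V \<times> V)"
  define X where "X a z = (if a + z \<in> V then 1 else 0 :: real)" for a z
  have finZ: "finite Z" using fin by (simp add: Z_def)
  have gram: "(\<Sum>z\<in>Z. X a z * X b z) = real (rep V (a - b))" if "a \<in> V" "b \<in> V" for a b
  proof -
    have "(\<Sum>z\<in>Z. X a z * X b z) = (\<Sum>z\<in>Z. if a + z \<in> V \<and> b + z \<in> V then 1 else 0)"
      by (intro sum.cong) (auto simp: X_def)
    also have "\<dots> = real (card {z \<in> Z. a + z \<in> V \<and> b + z \<in> V})"
      using finZ by (simp add: sum.If_cases Int_def)
    also have "card {z \<in> Z. a + z \<in> V \<and> b + z \<in> V} = rep V (a - b)"
      unfolding rep_def
    proof (rule bij_betw_same_card[of "\<lambda>z. b + z"])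
      show "bij_betw (\<lambda>z. b + z) {z \<in> Z. a + z \<in> V \<and> b + z \<in> V} {x \<in> V. x + (a - b) \<in> V}"
      proof (rule bij_betw_byWitness[of _ "\<lambda>x. x - b"])
        show "(\<lambda>x. x - b) ` {x \<in> V. x + (a - b) \<in> V} \<subseteq> {z \<in> Z. a + z \<in> V \<and> b + z \<in> V}"
          using that by (auto simp: Z_def algebra_simps)
      qed (auto simp: algebra_simps)
    qed
    finally show ?thesis .
  qed
  show ?thesis
    using gram_triangle_sum_ge[OF fin, of X Z] by (simp add: gram energy_def)
qed

lemma sum_mult_sum_mult_sum:
  fixes a :: "'a \<Rightarrow> real"
  shows "sum a I * sum b J * sum c K = (\<Sum>(i, j, k)\<in>I \<times> J \<times> K. a i * b j * c k)"
proof -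
  have bc: "sum b J * sum c K = (\<Sum>q\<in>J \<times> K. b (fst q) * c (snd q))"
    by (simp only: sum_product sum.cartesian_product case_prod_unfold)
  show ?thesis
    by (simp only: mult.assoc bc) (simp only: sum_product sum.cartesian_product case_prod_unfold)
qed
lemma square_le_sum: "real m ^ 2 \<le> (\<Sum>t=1..m. 2 * real t)"
  by (induction m) (auto simp: power2_eq_square algebra_simps)

section \<open>Energy of a set that hardly grows under multiplication by \<open>A\<close>\<close>

context
  fixes A V :: "real set" and L h \<kappa> \<tau> :: real
  assumes finA: "finite A" and finV: "finite V" and A: "A \<noteq> {}" "0 \<notin> A" and V0: "0 \<notin> V"
    and L: "real (card V) \<le> L" "real (card (A * V)) \<le> L" "real (card (A * (A * V))) \<le> L" "0 < L"
    and h: "1 \<le> h" "\<And>m. m \<le> card V ^ 2 \<Longrightarrow> (\<Sum>t=1..m. 1 / real t) \<le> h"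
    and \<kappa>: "\<kappa> = 100 * L ^ 4 / card A"
    and \<tau>: "0 < \<tau>" "\<tau> ^ 3 = h / card A"
begin

lemma kappa_pos: "\<kappa> > 0"
  using finA A L by (simp add: \<kappa> card_gt_0_iff)

text \<open>The number \<open>\<kappa>\<close> is what \<open>card_rich_shifts_le\<close> yields
  when \<open>W\<close> and \<open>A * W\<close> have at most \<open>L\<close> elements. The set
  \<open>W\<close> is kept general because both \<open>V\<close> and \<open>A * V\<close> are
  substituted for it.\<close>

lemma card_popular_le:
  assumes "finite W" "0 \<notin> W" "real (card W) \<le> L" "real (card (A * W)) \<le> L"
    and "finite D" "t \<ge> 1" "\<And>d. d \<in> D \<Longrightarrow> t \<le> rep W d"
  shows "real (card D) * real t ^ 3 \<le> \<kappa>"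
proof -
  have n: "card A > 0" using finA A by (simp add: card_gt_0_iff)
  have "real (card A) * real (card D) * real t ^ 3 \<le> 100 * real (card W) ^ 2 * real (card (A * W)) ^ 2"
    using assms finA A by (intro card_rich_shifts_le) (auto simp: rep_def)
  also have "\<dots> \<le> 100 * L ^ 2 * L ^ 2"
    using assms by (intro mult_mono power_mono) auto
  finally show ?thesis using n by (simp add: \<kappa> field_simps eval_nat_numeral)
qed

lemma sum_rep_cubes_le:
  "(\<Sum>d\<in>(\<lambda>(a, a'). a - a') ` (V \<times> V). real (rep V d) ^ 3) \<le> 3 * \<kappa> * h"
proof -
  let ?D = "(\<lambda>(a, a'). a - a') ` (V \<times> V)"
  have "(\<Sum>d\<in>?D. real (rep V d) ^ 3) \<le> 3 * \<kappa> * (\<Sum>t=1..card V. 1 / real t)"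
  proof (rule sum_cube_le_if_card_ge_le)
    show "real (card {s \<in> ?D. t \<le> rep V s}) * real t ^ 3 \<le> \<kappa>" if "1 \<le> t" for t
      using finV V0 L that by (intro card_popular_le) auto
  qed (use finV rep_le_card in auto)
  also have "\<dots> \<le> 3 * \<kappa> * h"
    using kappa_pos by (intro mult_left_mono h) (auto simp: power2_eq_square)
  finally show ?thesis .
qed

text \<open>Leaving out 0 meets the condition on \<open>D3\<close> in
  \<open>card_additive_triples_le\<close>; differences equal to 0 come from degenerate triangles,
  which are counted separately. The set \<open>level 1\<close> consists of all nonzero differences
  of \<open>V\<close>.\<close>

definition level :: "nat \<Rightarrow> real set" where
  "level t = {d \<in> (\<lambda>(a, a'). a - a') ` (V \<times> V). d \<noteq> 0 \<and> t \<le> rep V d}"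

lemma finite_level: "finite (level t)"
  using finV by (simp add: level_def)

text \<open>Multiplication by \<open>c \<in> A\<close> carries representations of \<open>e\<close>
  in \<open>V\<close> to representations of \<open>c * e\<close> in \<open>A * V\<close>. Hence all
  of \<open>A * level t\<close> is popular for \<open>A * V\<close>, and its size obeys the same
  bound as that of \<open>level t\<close>.\<close>

lemma card_level_le:
  assumes "t \<ge> 1"
  shows "real (card (A * level t)) \<le> \<kappa> / real t ^ 3" "real (card (level t)) \<le> \<kappa> / real t ^ 3"
    "card (level t) \<le> card V ^ 2"
proof -
  have "t \<le> rep (A * V) d" if "d \<in> A * level t" for d
  proof -
    from that obtain c e where ce: "d = c * e" "c \<in> A" "t \<le> rep V e" by (auto simp: level_def elim!: set_times_elim)
    have "rep V e \<le> rep (A * V) (c * e)"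
      unfolding rep_def
    proof (rule card_inj_on_le[of "\<lambda>x. c * x"])
      show "inj_on (\<lambda>x. c * x) {x \<in> V. x + e \<in> V}" using ce A by (auto intro: inj_onI)
      show "(\<lambda>x. c * x) ` {x \<in> V. x + e \<in> V} \<subseteq> {x \<in> A * V. x + c * e \<in> A * V}"
        using ce by (auto simp: distrib_left [symmetric])
    qed (use finA finV in \<open>simp add: finite_set_times\<close>)
    then show ?thesis using ce by simp
  qed
  then have "real (card (A * level t)) * real t ^ 3 \<le> \<kappa>"
    using finA finV A V0 L assms finite_level
    by (intro card_popular_le[where W = "A * V"]) (auto simp: finite_set_times elim!: set_times_elim)
  then show 1: "real (card (A * level t)) \<le> \<kappa> / real t ^ 3" using assms by (simp add: field_simps)
  obtain a where "a \<in> A" "a \<noteq> 0" using A by fastforce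
  then have "card (level t) \<le> card (level t * A)"
    using finA finite_level by (intro card_le_card_set_times)
  then show "real (card (level t)) \<le> \<kappa> / real t ^ 3" using 1 by (simp add: mult.commute)
  have "card (level t) \<le> card ((\<lambda>(a, a'). a - a') ` (V \<times> V))"
    using finV by (intro card_mono) (auto simp: level_def)
  also have "\<dots> \<le> card (V \<times> V)" using finV by (intro card_image_le) simp
  finally show "card (level t) \<le> card V ^ 2" by (simp add: card_cartesian_product power2_eq_square)
qed

text \<open>Each squared count is expanded over levels with weights \<open>2 * t\<close>. Levels
  \<open>(i, j, k)\<close> then carry weight \<open>8 * i * j * k\<close> against
  \<open>301 * \<kappa> ^ 2 * \<tau> / (i * j * k) ^ 2\<close> triples, which leaves three harmonic
  sums and the constant \<open>2408 = 8 * 301\<close>.\<close>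

lemma sum_rep_squares_triples_le:
  defines "P \<equiv> {(d, e). d \<in> level 1 \<and> e \<in> level 1 \<and> e - d \<in> level 1}"
  shows "(\<Sum>(d, e)\<in>P. (real (rep V d) * real (rep V e) * real (rep V (e - d))) ^ 2)
    \<le> 2408 * \<kappa> ^ 2 * \<tau> * h ^ 3"
proof -
  define m where "m = card V"
  define g where "g t d = (if d \<in> level t then 2 * real t else 0)" for t d
  have finP: "finite P"
    by (rule finite_subset[of _ "level 1 \<times> level 1"]) (use finite_level in \<open>auto simp: P_def\<close>)
  have g: "real (rep V d) ^ 2 \<le> (\<Sum>t=1..m. g t d)" if "d \<in> level 1" for d
  proof -
    have "rep V d \<le> m" unfolding m_def using finV by (rule rep_le_card)
    then have eq: "{1..m} \<inter> {t. d \<in> level t} = {1..rep V d}" using that by (auto simp: level_def)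
    have "(\<Sum>t=1..m. g t d) = (\<Sum>t=1..rep V d. 2 * real t)"
      unfolding g_def using eq by (simp add: sum.If_cases)
    then show ?thesis using square_le_sum by simp
  qed
  have g0: "0 \<le> g t d" for t d by (simp add: g_def)
  let ?I = "{1..m} \<times> {1..m} \<times> {1..m}"
  have "(\<Sum>(d, e)\<in>P. (real (rep V d) * real (rep V e) * real (rep V (e - d))) ^ 2)
      \<le> (\<Sum>(d, e)\<in>P. (\<Sum>t=1..m. g t d) * (\<Sum>t=1..m. g t e) * (\<Sum>t=1..m. g t (e - d)))"
  proof (rule sum_mono)
    fix p assume "p \<in> P"
    then obtain d e where "p = (d, e)" "d \<in> level 1" "e \<in> level 1" "e - d \<in> level 1" by (auto simp: P_def)
    then show "(case p of (d, e) \<Rightarrow> (real (rep V d) * real (rep V e) * real (rep V (e - d))) ^ 2)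
        \<le> (case p of (d, e) \<Rightarrow> (\<Sum>t=1..m. g t d) * (\<Sum>t=1..m. g t e) * (\<Sum>t=1..m. g t (e - d)))"
      using g g0 by (auto simp: power_mult_distrib intro!: mult_mono sum_nonneg mult_nonneg_nonneg)
  qed
  also have "\<dots> = (\<Sum>p\<in>P. \<Sum>q\<in>?I. case p of (d, e) \<Rightarrow> case q of (i, j, k) \<Rightarrow> g i d * g j e * g k (e - d))"
    unfolding sum_mult_sum_mult_sum by (simp add: case_prod_unfold)
  also have "\<dots> = (\<Sum>q\<in>?I. \<Sum>p\<in>P. case p of (d, e) \<Rightarrow> case q of (i, j, k) \<Rightarrow> g i d * g j e * g k (e - d))"
    by (rule sum.swap)
  also have "\<dots> \<le> (\<Sum>(i, j, k)\<in>?I. 2408 * \<kappa> ^ 2 * \<tau> * ((1 / real i) * (1 / real j) * (1 / real k)))"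
  proof (rule sum_mono)
    fix q assume "q \<in> ?I"
    then obtain i j k where q: "q = (i, j, k)" and t: "i \<ge> 1" "j \<ge> 1" "k \<ge> 1" by auto
    let ?T = "{(d, e). d \<in> level i \<and> e \<in> level j \<and> e - d \<in> level k}"
    have finT: "finite ?T"
      by (rule finite_subset[of _ "level i \<times> level j"]) (use finite_level in auto)
    have "(\<Sum>p\<in>P. case p of (d, e) \<Rightarrow> g i d * g j e * g k (e - d))
        \<le> (\<Sum>p\<in>P. if p \<in> ?T then 8 * real i * real j * real k else 0)"
      by (intro sum_mono) (auto simp: q g_def split: if_splits)
    also have "\<dots> = 8 * real i * real j * real k * real (card (P \<inter> ?T))"
      using finP by (simp add: sum.If_cases Int_def)
    also have "\<dots> \<le> 8 * real i * real j * real k * real (card ?T)"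
      using finT by (intro mult_left_mono) (auto intro: card_mono)
    also have "\<dots> \<le> 8 * real i * real j * real k * (301 * \<kappa> ^ 2 * \<tau> / (real i * real j * real k) ^ 2)"
    proof (intro mult_left_mono card_additive_triples_le[where A = A and h = h])
      show "(\<Sum>t=1..card (level j). 1 / real t) \<le> h" using card_level_le(3)[OF t(2)] by (rule h)
      show "0 \<notin> level k" by (simp add: level_def)
    qed (use card_level_le t finA A kappa_pos h \<tau> finite_level in auto)
    also have "\<dots> = 2408 * \<kappa> ^ 2 * \<tau> * ((1 / real i) * (1 / real j) * (1 / real k))"
      using t by (simp add: field_simps eval_nat_numeral)
    finally show "(\<Sum>p\<in>P. case p of (d, e) \<Rightarrow> case q of (i, j, k) \<Rightarrow> g i d * g j e * g k (e - d))
        \<le> (case q of (i, j, k) \<Rightarrow> 2408 * \<kappa> ^ 2 * \<tau> * ((1 / real i) * (1 / real j) * (1 / real k)))"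
      by (simp add: q)
  qed
  also have "\<dots> = 2408 * \<kappa> ^ 2 * \<tau> * (\<Sum>(i, j, k)\<in>?I. (1 / real i) * (1 / real j) * (1 / real k))"
    by (simp only: sum_distrib_left case_prod_unfold)
  also have "\<dots> = 2408 * \<kappa> ^ 2 * \<tau> * (\<Sum>t=1..m. 1 / real t) ^ 3"
    by (simp only: sum_mult_sum_mult_sum [symmetric] power3_eq_cube)
  also have "\<dots> \<le> 2408 * \<kappa> ^ 2 * \<tau> * h ^ 3"
  proof (intro mult_left_mono power_mono)
    show "(\<Sum>t=1..m. 1 / real t) \<le> h" unfolding m_def by (rule h) (simp add: power2_eq_square)
  qed (use kappa_pos \<tau> in \<open>auto intro: sum_nonneg\<close>)
  finally show ?thesis .
qed

text \<open>The summand depends only on the differences \<open>(a - b, a - c)\<close>. Grouping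
  nondegenerate triples by them, Cauchy--Schwarz bounds their sum by the number of collisions, which
  is at most the third moment of \<open>rep V\<close>, times the sum of squares over difference
  triples. Degenerate triples give the term \<open>9 * L * \<kappa> * h\<close>.\<close>

lemma triangle_sum_le:
  "(\<Sum>a\<in>V. \<Sum>b\<in>V. \<Sum>c\<in>V. real (rep V (a - b)) * real (rep V (b - c)) * real (rep V (a - c)))
    \<le> 9 * L * \<kappa> * h + sqrt (7224 * \<kappa> ^ 3 * \<tau>) * h ^ 2"
proof -
  define r where "r d = real (rep V d)" for d
  define D where "D = (\<lambda>(a, a'). a - a') ` (V \<times> V)"
  have r0: "0 \<le> r d" and sym: "r (- d) = r d" for d by (simp_all add: r_def rep_uminus)
  have r_zero: "r 0 = card V" by (simp add: r_def rep_def)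
  define E3 where "E3 = (\<Sum>d\<in>D. r d ^ 3)"
  have E3: "0 \<le> E3" "E3 \<le> 3 * \<kappa> * h"
    unfolding E3_def D_def r_def using sum_rep_cubes_le by (auto intro: sum_nonneg)
  have pairs: "(\<Sum>a\<in>V. \<Sum>b\<in>V. r (a - b) ^ 2) = E3"
    unfolding sum_differences[OF finV, of "\<lambda>d. r d ^ 2"] E3_def D_def
    by (simp add: r_def power2_eq_square power3_eq_cube mult.assoc)
  define F where "F = (\<lambda>(a, b, c). r (a - b) * r (b - c) * r (a - c))"
  define N where "N = {(a, b, c). a \<in> V \<and> b \<in> V \<and> c \<in> V \<and> a \<noteq> b \<and> b \<noteq> c \<and> a \<noteq> c}"
  have finN: "finite N"
    by (rule finite_subset[of _ "V \<times> V \<times> V"]) (use finV in \<open>auto simp: N_def\<close>)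

  define f where "f = (\<lambda>(a, b, c). (a - b, a - c :: real))"
  define g where "g = (\<lambda>(d, e). r d * r e * r (e - d))"
  define P where "P = {(d, e). d \<in> level 1 \<and> e \<in> level 1 \<and> e - d \<in> level 1}"
  have finP: "finite P"
    by (rule finite_subset[of _ "level 1 \<times> level 1"]) (use finite_level in \<open>auto simp: P_def\<close>)
  have Fg: "F s = g (f s)" for s
    by (cases s) (simp add: F_def g_def f_def mult_ac)
  have "level 1 = D - {0}"
  proof -
    have "rep V d \<ge> 1" if "d \<in> D" for d
    proof -
      from that obtain a b where "a \<in> V" "b \<in> V" "d = a - b" by (auto simp: D_def)
      then have "b \<in> {x \<in> V. x + d \<in> V}" by simp
      then show ?thesis
        unfolding rep_def using finV by (auto simp: Suc_le_eq card_gt_0_iff)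
    qed
    then show ?thesis unfolding level_def D_def [symmetric] by blast
  qed
  note level1 = this
  have img: "f ` N \<subseteq> P"
  proof (rule image_subsetI)
    fix s assume "s \<in> N"
    then obtain a b c where s: "s = (a, b, c)" "a \<in> V" "b \<in> V" "c \<in> V" "a \<noteq> b" "b \<noteq> c" "a \<noteq> c"
      unfolding N_def by blast
    have "x - y \<in> level 1" if "x \<in> V" "y \<in> V" "x \<noteq> y" for x y
      unfolding level1 D_def using that by (auto intro!: image_eqI[of _ _ "(x, y)"])
    moreover have "(a - c) - (a - b) = b - c" by simp
    ultimately show "f s \<in> P" using s(2-) by (simp add: s(1) f_def P_def)
  qed
  \<comment> \<open>Two triples with the same differences are translates of each other by some
    \<open>z\<close>; given \<open>z\<close>, each of \<open>a\<close>, \<open>b\<close>,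
    \<open>c\<close> has at most \<open>rep V z\<close> choices.\<close>
  have coll: "real (card {(s, s'). s \<in> N \<and> s' \<in> N \<and> f s = f s'}) \<le> E3"
  proof -
    let ?S = "\<lambda>z. {x \<in> V. x + z \<in> V}"
    have "card {(s, s'). s \<in> N \<and> s' \<in> N \<and> f s = f s'} \<le> card (SIGMA z : D. ?S z \<times> ?S z \<times> ?S z)"
    proof (rule card_inj_on_le[of "\<lambda>((a, b, c), (a', b', c')). (a' - a, (a, b, c))"])
      show "inj_on (\<lambda>((a, b, c), (a', b', c')). (a' - a, (a, b, c))) {(s, s'). s \<in> N \<and> s' \<in> N \<and> f s = f s'}"
      proof (rule inj_onI)
        fix p q
        assume pq: "p \<in> {(s, s'). s \<in> N \<and> s' \<in> N \<and> f s = f s'}" "q \<in> {(s, s'). s \<in> N \<and> s' \<in> N \<and> f s = f s'}"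
          "(\<lambda>((a, b, c), (a', b', c')). (a' - a, (a, b, c))) p = (\<lambda>((a, b, c), (a', b', c')). (a' - a, (a, b, c))) q"
        obtain a b c a' b' c' where p: "p = ((a, b, c), (a', b', c'))" by (metis prod_cases3 surj_pair)
        obtain a2 b2 c2 a2' b2' c2' where q: "q = ((a2, b2, c2), (a2', b2', c2'))"
          by (metis prod_cases3 surj_pair)
        have "a2 = a" "b2 = b" "c2 = c" "a2' = a'" "a - b = a' - b'" "a - c = a' - c'"
          "a2 - b2 = a2' - b2'" "a2 - c2 = a2' - c2'"
          using pq by (simp_all add: p q f_def)
        then show "p = q" by (simp add: p q)
      qed
      show "(\<lambda>((a, b, c), (a', b', c')). (a' - a, (a, b, c))) ` {(s, s'). s \<in> N \<and> s' \<in> N \<and> f s = f s'}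
          \<subseteq> (SIGMA z : D. ?S z \<times> ?S z \<times> ?S z)"
      proof (rule image_subsetI)
        fix p assume "p \<in> {(s, s'). s \<in> N \<and> s' \<in> N \<and> f s = f s'}"
        moreover obtain a b c a' b' c' where p: "p = ((a, b, c), (a', b', c'))" by (metis prod_cases3 surj_pair)
        ultimately have V: "a \<in> V" "b \<in> V" "c \<in> V" "a' \<in> V" "b' \<in> V" "c' \<in> V"
          and "a - b = a' - b'" "a - c = a' - c'" by (auto simp: N_def f_def)
        then have "b + (a' - a) = b'" "c + (a' - a) = c'" "a + (a' - a) = a'" by linarith+
        with V show "(\<lambda>((a, b, c), (a', b', c')). (a' - a, (a, b, c))) p \<in> (SIGMA z : D. ?S z \<times> ?S z \<times> ?S z)"
          by (auto simp: p D_def)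
      qed
      show "finite (SIGMA z : D. ?S z \<times> ?S z \<times> ?S z)"
        using finV by (intro finite_SigmaI) (auto simp: D_def)
    qed
    also have "\<dots> = (\<Sum>z\<in>D. rep V z ^ 3)"
      using finV by (simp add: D_def card_cartesian_product rep_def power3_eq_cube mult.assoc)
    finally have "real (card {(s, s'). s \<in> N \<and> s' \<in> N \<and> f s = f s'}) \<le> real (\<Sum>z\<in>D. rep V z ^ 3)"
      by (simp only: of_nat_le_iff)
    then show ?thesis by (simp add: E3_def r_def)
  qed
  have "sum F N ^ 2 = (\<Sum>s\<in>N. g (f s)) ^ 2" by (simp add: Fg)
  also have "\<dots> \<le> real (card {(s, s'). s \<in> N \<and> s' \<in> N \<and> f s = f s'}) * (\<Sum>i\<in>f ` N. g i ^ 2)"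
    by (rule sum_squared_le_collisions[OF finN])
  also have "\<dots> \<le> (3 * \<kappa> * h) * (2408 * \<kappa> ^ 2 * \<tau> * h ^ 3)"
  proof (rule mult_mono)
    have "(\<Sum>i\<in>f ` N. g i ^ 2) \<le> (\<Sum>i\<in>P. g i ^ 2)"
      using finP img by (intro sum_mono2) auto
    also have "\<dots> \<le> 2408 * \<kappa> ^ 2 * \<tau> * h ^ 3"
      using sum_rep_squares_triples_le by (simp add: P_def g_def r_def case_prod_unfold)
    finally show "(\<Sum>i\<in>f ` N. g i ^ 2) \<le> 2408 * \<kappa> ^ 2 * \<tau> * h ^ 3" .
  qed (use coll E3 in \<open>auto intro: sum_nonneg\<close>)
  also have "\<dots> = (7224 * \<kappa> ^ 3 * \<tau>) * (h ^ 2) ^ 2" by (simp add: eval_nat_numeral)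
  finally have "sum F N \<le> sqrt ((7224 * \<kappa> ^ 3 * \<tau>) * (h ^ 2) ^ 2)" by (rule real_le_rsqrt)
  also have "\<dots> = sqrt (7224 * \<kappa> ^ 3 * \<tau>) * h ^ 2"
    using h unfolding real_sqrt_mult real_sqrt_abs by simp
  finally have nondeg: "sum F N \<le> sqrt (7224 * \<kappa> ^ 3 * \<tau>) * h ^ 2" .

  have swap: "r (b - a) = r (a - b)" for a b using sym[of "a - b"] by simp
  \<comment> \<open>When two of the three points coincide, one factor is \<open>r 0 = card V\<close>
    and the other two agree by symmetry. Overlaps between the three cases only enlarge the
    right-hand side.\<close>
  have "F (a, b, c) \<le> (if (a, b, c) \<in> N then F (a, b, c) else 0)
      + (if b = a then card V * r (a - c) ^ 2 else 0)
      + (if c = b then card V * r (a - b) ^ 2 else 0)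
      + (if c = a then card V * r (a - b) ^ 2 else 0)" if "a \<in> V" "b \<in> V" "c \<in> V" for a b c
    using that r0 by (auto simp: F_def N_def r_zero power2_eq_square swap[of b a] mult_ac)
  then have "(\<Sum>a\<in>V. \<Sum>b\<in>V. \<Sum>c\<in>V. F (a, b, c))
      \<le> (\<Sum>a\<in>V. \<Sum>b\<in>V. \<Sum>c\<in>V. (if (a, b, c) \<in> N then F (a, b, c) else 0)
      + (if b = a then card V * r (a - c) ^ 2 else 0)
      + (if c = b then card V * r (a - b) ^ 2 else 0)
      + (if c = a then card V * r (a - b) ^ 2 else 0))"
    by (intro sum_mono) blast
  also have "\<dots> = (\<Sum>a\<in>V. \<Sum>b\<in>V. \<Sum>c\<in>V. if (a, b, c) \<in> N then F (a, b, c) else 0)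
      + (\<Sum>a\<in>V. \<Sum>b\<in>V. \<Sum>c\<in>V. if b = a then card V * r (a - c) ^ 2 else 0)
      + (\<Sum>a\<in>V. \<Sum>b\<in>V. \<Sum>c\<in>V. if c = b then card V * r (a - b) ^ 2 else 0)
      + (\<Sum>a\<in>V. \<Sum>b\<in>V. \<Sum>c\<in>V. if c = a then card V * r (a - b) ^ 2 else 0)"
    by (simp only: sum.distrib)
  also have "(\<Sum>a\<in>V. \<Sum>b\<in>V. \<Sum>c\<in>V. if (a, b, c) \<in> N then F (a, b, c) else 0)
      = (\<Sum>s\<in>V \<times> V \<times> V. if s \<in> N then F s else 0)"
    by (simp only: sum.cartesian_product case_prod_unfold prod.collapse)
  also have "\<dots> = sum F N"
  proof -
    have "(V \<times> V \<times> V) \<inter> {s. s \<in> N} = N" by (auto simp: N_def)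
    then show ?thesis using finV by (simp add: sum.If_cases)
  qed
  also have "(\<Sum>a\<in>V. \<Sum>b\<in>V. \<Sum>c\<in>V. if b = a then card V * r (a - c) ^ 2 else 0) = card V * E3"
  proof -
    have "(\<Sum>b\<in>V. \<Sum>c\<in>V. if b = a then card V * r (a - c) ^ 2 else 0)
        = (\<Sum>c\<in>V. card V * r (a - c) ^ 2)" if "a \<in> V" for a
      using that finV by (subst sum.swap) (simp add: sum.delta)
    then show ?thesis by (simp add: pairs [symmetric] sum_distrib_left)
  qed
  also have "(\<Sum>a\<in>V. \<Sum>b\<in>V. \<Sum>c\<in>V. if c = b then card V * r (a - b) ^ 2 else 0) = card V * E3"
    using finV by (simp add: sum.delta pairs [symmetric] sum_distrib_left)
  also have "(\<Sum>a\<in>V. \<Sum>b\<in>V. \<Sum>c\<in>V. if c = a then card V * r (a - b) ^ 2 else 0) = card V * E3"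
    using finV by (simp add: sum.delta pairs [symmetric] sum_distrib_left)
  finally have "(\<Sum>a\<in>V. \<Sum>b\<in>V. \<Sum>c\<in>V. F (a, b, c)) \<le> 3 * (card V * E3) + sum F N" by (simp add: mult_ac)
  moreover have "card V * E3 \<le> L * (3 * \<kappa> * h)" using L E3 by (intro mult_mono) auto
  ultimately have "(\<Sum>a\<in>V. \<Sum>b\<in>V. \<Sum>c\<in>V. F (a, b, c)) \<le> 9 * L * \<kappa> * h + sqrt (7224 * \<kappa> ^ 3 * \<tau>) * h ^ 2"
    using nondeg by linarith
  then show ?thesis by (simp add: F_def r_def)
qed

lemma energy_cubed_upper:
  "energy V ^ 3 \<le> L ^ 3 * (9 * L * \<kappa> * h + sqrt (7224 * \<kappa> ^ 3 * \<tau>) * h ^ 2)"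
proof -
  let ?S = "\<Sum>a\<in>V. \<Sum>b\<in>V. \<Sum>c\<in>V. real (rep V (a - b)) * real (rep V (b - c)) * real (rep V (a - c))"
  have "energy V ^ 3 \<le> real (card V) ^ 3 * ?S" by (rule energy_cubed_le[OF finV])
  also have "\<dots> \<le> L ^ 3 * (9 * L * \<kappa> * h + sqrt (7224 * \<kappa> ^ 3 * \<tau>) * h ^ 2)"
    using L by (intro mult_mono power_mono triangle_sum_le) (auto intro!: sum_nonneg)
  finally show ?thesis .
qed

end

section \<open>Bases of sets with small product set\<close>

text \<open>Cubing the lower bound gives \<open>n ^ 21\<close> against
  \<open>M ^ 27 * E ^ 3\<close>, and \<open>E ^ 3\<close> is at most about \<open>n\<close> to the
  power \<open>22 / 3\<close>; the quotient has exponent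
  \<open>21 - 22 / 3 = 41 / 3\<close>.\<close>

lemma basis_bound:
  fixes A B :: "real set"
  assumes finA: "finite A" and finB: "finite B" and A: "A \<noteq> {}" "0 \<notin> A" and basis: "A \<subseteq> B + B"
    and K: "1 \<le> K" "real (card (A * A)) \<le> K * real (card A)"
    and h: "1 \<le> h" "\<And>m. m \<le> card (A * A) ^ 2 \<or> m = 2 * card B \<Longrightarrow> (\<Sum>t=1..m. 1 / real t) \<le> h"
  shows "real (card A) powr (41 / 3) \<le> 38408 ^ 3 * 85900 * real (card B) ^ 27 * h ^ 6 * K ^ 36"
proof -
  define n where "n = real (card A)"
  define M where "M = real (card B)"
  define V where "V = A * A"
  define E where "E = energy V"
  have n: "n > 0" using A finA by (simp add: n_def card_gt_0_iff)
  \<comment> \<open>Every power of \<open>n\<close> that occurs is an integer power of its sixth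
    root: \<open>\<tau>\<close> contains \<open>w ^ 2\<close>, \<open>\<kappa>\<close> contains
    \<open>w ^ 18\<close>, and the square root of \<open>\<kappa> ^ 3 * \<tau>\<close> contains
    \<open>w ^ 26\<close>.\<close>
  define w where "w = n powr (1 / 6)"
  have w: "w \<ge> 1" and n_w: "n = w ^ 6"
    using n by (auto simp: w_def n_def powr_power ge_one_powr_ge_zero)
  \<comment> \<open>The largest set to be controlled is \<open>A * (A * V) = A ^ 4\<close>, hence
    the fourth power of \<open>K\<close>.\<close>
  define L where "L = K ^ 4 * n"
  have L0: "L > 0" using K n by (simp add: L_def)
  have pw: "real (card (A ^ k)) \<le> L" if "k \<le> 4" for k
  proof -
    have "real (card (A ^ k)) \<le> K ^ k * n"
      unfolding n_def using finA A K by (intro pluennecke)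
    also have "\<dots> \<le> L" unfolding L_def using K n that by (intro mult_right_mono power_increasing) auto
    finally show ?thesis .
  qed
  have pw4: "real (card (A ^ 2)) \<le> L" "real (card (A ^ 3)) \<le> L" "real (card (A ^ 4)) \<le> L"
    by (rule pw, simp)+
  have V: "V = A ^ 2" "A * V = A ^ 3" "A * (A * V) = A ^ 4"
    by (simp_all only: V_def power2_eq_square power3_eq_cube power4_eq_xxxx mult.assoc)
  define \<eta> where "\<eta> = root 3 h"
  have \<eta>: "\<eta> > 0" "\<eta> ^ 3 = h" using h by (auto simp: \<eta>_def)
  have "\<eta> \<ge> 1" using h by (simp add: \<eta>_def)
  then have \<eta>_h: "\<eta> \<le> h" using self_le_power[of \<eta> 3] \<eta> by simp
  define \<tau> where "\<tau> = \<eta> / w ^ 2"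
  have \<tau>: "0 < \<tau>" "\<tau> ^ 3 = h / card A"
    using \<eta> w by (simp_all add: \<tau>_def power_divide n_w [unfolded n_def] power_mult [symmetric])
  define \<kappa> where "\<kappa> = 100 * L ^ 4 / card A"
  have \<kappa>: "\<kappa> = 100 * K ^ 16 * w ^ 18"
    unfolding \<kappa>_def L_def n_def [symmetric] using w
    by (simp add: n_w power_mult_distrib power_mult [symmetric] divide_simps power_add [symmetric])
  have "E ^ 3 \<le> L ^ 3 * (9 * L * \<kappa> * h + sqrt (7224 * \<kappa> ^ 3 * \<tau>) * h ^ 2)"
    unfolding E_def
  proof (rule energy_cubed_upper[where A = A])
    show "finite V" "0 \<notin> V" using finA A by (auto simp: V finite_set_power zero_notin_set_power)
    show "real (card V) \<le> L" "real (card (A * V)) \<le> L" "real (card (A * (A * V))) \<le> L"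
      using pw4 by (simp_all only: V(1)[symmetric] V(2)[symmetric] V(3)[symmetric])
  qed (use finA A L0 h \<tau> \<kappa>_def in \<open>auto simp: V_def\<close>)
  also have "\<dots> \<le> L ^ 3 * (85900 * K ^ 24 * w ^ 26 * h ^ 3)"
  proof (rule mult_left_mono)
    \<comment> \<open>The degenerate term is of order \<open>w ^ 24\<close>, below the main term of
      order \<open>w ^ 26\<close>.\<close>
    have "9 * L * \<kappa> * h = 900 * K ^ 20 * w ^ 24 * h"
    proof -
      have pow: "K ^ 20 = K ^ 4 * K ^ 16" "w ^ 24 = w ^ 6 * w ^ 18" by (simp_all flip: power_add)
      show ?thesis unfolding L_def \<kappa> n_w pow by (simp add: mult_ac)
    qed
    also have "\<dots> \<le> 900 * K ^ 24 * w ^ 26 * h ^ 3"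
      using K w h self_le_power[of h 3] by (intro mult_mono power_increasing) auto
    finally have 1: "9 * L * \<kappa> * h \<le> 900 * K ^ 24 * w ^ 26 * h ^ 3" .
    have "\<kappa> ^ 3 * \<tau> = (1000 * K ^ 24 * w ^ 26) ^ 2 * \<eta>"
      unfolding \<kappa> \<tau>_def using w
    proof -
      have "w ^ 54 / w ^ 2 = w ^ 52" using w by (simp add: field_simps flip: power_add)
      moreover have "(w ^ 18) ^ 3 * (\<eta> / w ^ 2) = (w ^ 54 / w ^ 2) * \<eta>"
        by (simp flip: power_mult)
      ultimately have pow: "(w ^ 18) ^ 3 * (\<eta> / w ^ 2) = w ^ 52 * \<eta>" by simp
      show "(100 * K ^ 16 * w ^ 18) ^ 3 * (\<eta> / w ^ 2) = (1000 * K ^ 24 * w ^ 26) ^ 2 * \<eta>"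
        unfolding power_mult_distrib mult.assoc pow by (simp flip: power_mult)
    qed
    then have "7224 * \<kappa> ^ 3 * \<tau> = (1000 * K ^ 24 * w ^ 26) ^ 2 * (7224 * \<eta>)" by simp
    also have "\<dots> \<le> (1000 * K ^ 24 * w ^ 26) ^ 2 * (85 * h) ^ 2"
    proof (rule mult_left_mono)
      have "7224 * \<eta> \<le> 7225 * h" using \<eta>_h \<eta> by linarith
      also have "\<dots> \<le> 7225 * (h * h)" using h by (simp add: mult_le_cancel_left1)
      finally show "7224 * \<eta> \<le> (85 * h) ^ 2" by (simp add: power2_eq_square)
    qed simp
    also have "\<dots> = (85000 * K ^ 24 * w ^ 26 * h) ^ 2" by (simp add: power_mult_distrib)
    finally have "sqrt (7224 * \<kappa> ^ 3 * \<tau>) \<le> 85000 * K ^ 24 * w ^ 26 * h"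
      using K w h by (intro real_le_lsqrt) auto
    then have "sqrt (7224 * \<kappa> ^ 3 * \<tau>) * h ^ 2 \<le> (85000 * K ^ 24 * w ^ 26 * h) * h ^ 2"
      by (rule mult_right_mono) simp
    then have "sqrt (7224 * \<kappa> ^ 3 * \<tau>) * h ^ 2 \<le> 85000 * K ^ 24 * w ^ 26 * h ^ 3"
      by (simp add: eval_nat_numeral mult.assoc)
    with 1 show "9 * L * \<kappa> * h + sqrt (7224 * \<kappa> ^ 3 * \<tau>) * h ^ 2 \<le> 85900 * K ^ 24 * w ^ 26 * h ^ 3"
      by linarith
  qed (use L0 in simp)
  also have "\<dots> = 85900 * K ^ 36 * w ^ 44 * h ^ 3"
  proof -
    have "K ^ 36 = (K ^ 4) ^ 3 * K ^ 24" "w ^ 44 = (w ^ 6) ^ 3 * w ^ 26"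
      by (simp_all flip: power_add power_mult)
    then show ?thesis unfolding L_def n_w power_mult_distrib by (simp only: mult_ac)
  qed
  finally have E: "E ^ 3 \<le> 85900 * K ^ 36 * w ^ 44 * h ^ 3" .
  have "n ^ 7 \<le> 38408 * M ^ 9 * h * E"
    unfolding n_def M_def E_def V_def using finA finB A basis h
    by (intro energy_product_set_ge) auto
  then have "(n ^ 7) ^ 3 \<le> (38408 * M ^ 9 * h * E) ^ 3" using n by (intro power_mono) auto
  also have "\<dots> = 38408 ^ 3 * M ^ 27 * h ^ 3 * E ^ 3"
    by (simp add: power_mult_distrib power_mult [symmetric])
  also have "\<dots> \<le> 38408 ^ 3 * M ^ 27 * h ^ 3 * (85900 * K ^ 36 * w ^ 44 * h ^ 3)"
    using E h by (intro mult_left_mono) (auto simp: M_def)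
  also have "\<dots> = (38408 ^ 3 * 85900 * M ^ 27 * h ^ 6 * K ^ 36) * w ^ 44"
  proof -
    have "h ^ 6 = h ^ 3 * h ^ 3" by (simp flip: power_add)
    then show ?thesis by (simp only: mult_ac)
  qed
  finally have "w ^ 82 * w ^ 44 \<le> (38408 ^ 3 * 85900 * M ^ 27 * h ^ 6 * K ^ 36) * w ^ 44"
    by (simp add: n_w power_mult [symmetric] power_add [symmetric])
  then have "w ^ 82 \<le> 38408 ^ 3 * 85900 * M ^ 27 * h ^ 6 * K ^ 36"
    using w by (simp only: mult_le_cancel_right_pos zero_less_power less_le_trans[OF zero_less_one])
  moreover have "w ^ 82 = n powr (41 / 3)" using n by (simp add: w_def powr_power)
  ultimately show ?thesis by (simp add: n_def M_def)
qed

theorem theorem1: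
  "\<exists>\<epsilon>>0. \<exists>C>0. \<exists>\<eta> :: nat \<Rightarrow> real. \<eta> \<longlonglongrightarrow> 0 \<and>
     (\<forall>A B :: real set.
        finite A \<longrightarrow> finite B \<longrightarrow>
        real (card (A * A)) \<le> real (card A) powr (1 + \<epsilon>) \<longrightarrow>
        A \<subseteq> B + B \<longrightarrow>
        real (card A) powr (1/2 + 1/442 - \<eta> (card A)) \<le> C * real (card B))"
proof -
  \<comment> \<open>The losses \<open>h ^ 6 * K ^ 36\<close> amount to \<open>y ^ 42\<close> up to a
    constant, where \<open>y = N powr \<epsilon>\<close>. This choice is small enough because
    \<open>27 * e + 42 / 1000 \<le> 41 / 3\<close>.\<close>
  define \<epsilon> :: real where "\<epsilon> = 1 / 1000"
  define e :: real where "e = 1 / 2 + 1 / 442"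
  define C0 :: real where "C0 = 2 ^ 14 * (38408 ^ 3 * 85900 * 4001 ^ 6 * 2 ^ 36)"
  \<comment> \<open>Adding 1 gives \<open>C \<ge> 1\<close>, which settles the case
    \<open>N \<le> M\<close> and yields \<open>C0 \<le> C ^ 27\<close> before the 27th root is
    taken.\<close>
  define C where "C = 1 + C0"
  have C: "C \<ge> 1" "C > 0" by (simp_all add: C_def C0_def)
  have "real (card A) powr e \<le> C * real (card B)"
    if finA: "finite A" and finB: "finite B" and small: "real (card (A * A)) \<le> real (card A) powr (1 + \<epsilon>)"
      and basis: "A \<subseteq> B + B" for A B :: "real set"
  proof -
    define N where "N = real (card A)"
    define M where "M = real (card B)"
    have M_CM: "M \<le> C * M" using C by (simp add: M_def mult_le_cancel_right1)
    consider "A = {}" | "A \<noteq> {}" "N \<le> M" | "N > M" "A \<noteq> {}" by fastforce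
    then show ?thesis
    proof cases
      case 1
      then show ?thesis using C by simp
    next
      case 2
      then have "N \<ge> 1" using finA by (simp add: N_def Suc_le_eq card_gt_0_iff)
      then have "N powr e \<le> N powr 1" by (intro powr_mono) (auto simp: e_def)
      also have "\<dots> = N" using \<open>N \<ge> 1\<close> by simp
      finally show ?thesis using 2(2) M_CM by (simp only: N_def M_def)
    next
      case 3
      have "B \<noteq> {}" using 3 basis by (auto simp: set_plus_def)
      then have M: "M \<ge> 1" using finB by (simp add: M_def Suc_le_eq card_gt_0_iff)
      then have N2: "N \<ge> 2" using 3 by (simp add: N_def M_def)
      define y where "y = N powr \<epsilon>"
      have y: "y \<ge> 1" using N2 by (simp add: y_def \<epsilon>_def ge_one_powr_ge_zero)
      \<comment> \<open>The multiplicative estimates concern sets without 0. Removing it costs at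
        most one element, hence at most half of \<open>A\<close>, as
        \<open>N \<ge> 2\<close>.\<close>
      define A' where "A' = A - {0}"
      define n where "n = real (card A')"
      have "card A - 1 \<le> card A'" by (simp add: A'_def card_Diff_singleton_if)
      then have "n \<ge> N - 1" unfolding n_def N_def by linarith
      then have n: "N \<le> 2 * n" "n \<ge> 1" using N2 by linarith+
      have "A' \<noteq> {}" using n by (auto simp: n_def)
      then have A': "finite A'" "A' \<noteq> {}" "0 \<notin> A'" "A' \<subseteq> B + B"
        using finA basis by (auto simp: A'_def)
      have sub: "A' * A' \<subseteq> A * A" by (intro set_times_mono2) (auto simp: A'_def)
      have fin2: "finite (A * A)" using finA by (simp add: finite_set_times)
      have "real (card (A' * A')) \<le> real (card (A * A))"
        using sub fin2 by (simp add: card_mono)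
      also have "\<dots> \<le> N * y" using small N2 by (simp add: N_def y_def powr_add)
      also have "\<dots> \<le> (2 * n) * y" using n y by (intro mult_right_mono) auto
      finally have K: "real (card (A' * A')) \<le> (2 * y) * n" by (simp add: mult_ac)
      \<comment> \<open>Both ranges of \<open>m\<close> stay below \<open>N ^ 4\<close>, the second
        because \<open>M < N\<close>. The logarithm is absorbed by
        \<open>ln N \<le> y / \<epsilon> = 1000 * y\<close>, so
        \<open>1 + 4 * ln N \<le> 4001 * y\<close>.\<close>
      have h: "(\<Sum>t=1..m. 1 / real t) \<le> 4001 * y"
        if "m \<le> card (A' * A') ^ 2 \<or> m = 2 * card B" for m
      proof (cases "m = 0")
        case False
        have "card (A' * A') \<le> card (A * A)" using sub fin2 by (simp add: card_mono)
        also have "A * A = (\<lambda>(a, b). a * b) ` (A \<times> A)" by (auto simp: set_times_def)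
        also have "card \<dots> \<le> card (A \<times> A)" using finA by (intro card_image_le) simp
        also have "\<dots> = card A ^ 2" by (simp add: card_cartesian_product power2_eq_square)
        finally have "card (A' * A') ^ 2 \<le> (card A ^ 2) ^ 2" by (intro power_mono) auto
        moreover have "2 * card B \<le> (card A ^ 2) ^ 2"
        proof -
          have "2 * card B \<le> card A * card A"
            using N2 3 by (intro mult_le_mono) (auto simp: N_def M_def)
          also have "\<dots> \<le> (card A * card A) * (card A * card A)" by (rule le_square)
          finally show ?thesis by (simp add: power2_eq_square)
        qed
        ultimately have "m \<le> card A ^ 4" using that by auto
        then have "real m \<le> real (card A ^ 4)" by (simp only: of_nat_le_iff)
        then have mN: "real m \<le> N ^ 4" by (simp add: N_def)
        have "(\<Sum>t=1..m. 1 / real t) \<le> 1 + ln (real m)" by (rule sum_inverse_le_ln)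
        also have "\<dots> \<le> 1 + ln (N ^ 4)" using mN False by (simp add: ln_mono)
        also have "\<dots> = 1 + 4 * ln N" using N2 by (simp add: ln_realpow)
        also have "ln N \<le> y / \<epsilon>" unfolding y_def using N2 by (intro ln_powr_bound) (auto simp: \<epsilon>_def)
        finally have "(\<Sum>t=1..m. 1 / real t) \<le> 1 + 4 * (1000 * y)" by (simp add: \<epsilon>_def)
        then show ?thesis using y by linarith
      qed (use y in simp)
      have "n powr (41 / 3) \<le> 38408 ^ 3 * 85900 * M ^ 27 * (4001 * y) ^ 6 * (2 * y) ^ 36"
        unfolding n_def M_def
        using A' finB K y h by (intro basis_bound) (auto simp: n_def)
      also have "\<dots> = 38408 ^ 3 * 85900 * 4001 ^ 6 * 2 ^ 36 * M ^ 27 * (y ^ 6 * y ^ 36)"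
        by (simp only: power_mult_distrib mult_ac)
      also have "y ^ 6 * y ^ 36 = N powr (42 / 1000)"
        using N2 unfolding power_add [symmetric] y_def \<epsilon>_def by (simp add: powr_power)
      finally have n_bound: "n powr (41 / 3)
        \<le> 38408 ^ 3 * 85900 * 4001 ^ 6 * 2 ^ 36 * M ^ 27 * N powr (42 / 1000)" .
      have "N powr (27 * e) * N powr (42 / 1000) = N powr (27 * e + 42 / 1000)" by (simp add: powr_add)
      also have "\<dots> \<le> N powr (41 / 3)" using N2 by (intro powr_mono) (auto simp: e_def)
      also have "\<dots> \<le> (2 * n) powr (41 / 3)" using n N2 by (intro powr_mono2) auto
      also have "\<dots> = 2 powr (41 / 3) * n powr (41 / 3)" using n by (simp add: powr_mult)
      also have "2 powr (41 / 3) \<le> (2 :: real) powr (real 14)" by (intro powr_mono) auto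
      also have "(2 :: real) powr (real 14) = 2 ^ 14" by (rule powr_realpow) simp
      finally have "N powr (27 * e) * N powr (42 / 1000) \<le> 2 ^ 14 * n powr (41 / 3)"
        by (simp add: mult_right_mono)
      also have "\<dots> \<le> 2 ^ 14 * (38408 ^ 3 * 85900 * 4001 ^ 6 * 2 ^ 36 * M ^ 27 * N powr (42 / 1000))"
        by (rule mult_left_mono[OF n_bound]) simp
      also have "\<dots> = (C0 * M ^ 27) * N powr (42 / 1000)"
        by (simp only: C0_def mult_ac)
      finally have "N powr (27 * e) \<le> C0 * M ^ 27" using N2 by (simp add: mult_le_cancel_right_pos)
      moreover have "N powr (27 * e) = (N powr e) ^ 27" using N2 by (simp add: powr_power mult.commute)
      moreover have "C0 * M ^ 27 \<le> C ^ 27 * M ^ 27"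
      proof (rule mult_right_mono)
        have "C0 \<le> C" by (simp add: C_def)
        also have "\<dots> \<le> C ^ 27" using C by (intro self_le_power) auto
        finally show "C0 \<le> C ^ 27" .
      qed (use M in simp)
      ultimately have "(N powr e) ^ 27 \<le> (C * M) ^ 27" by (simp add: power_mult_distrib)
      then have "N powr e \<le> C * M" using C M by (subst (asm) power_mono_iff) auto
      then show ?thesis by (simp add: N_def M_def)
    qed
  qed
  then show ?thesis
    \<comment> \<open>The zero function is the witness for \<open>\<eta>\<close>: logarithms and
      powers of \<open>K\<close> are already absorbed in the gap between \<open>41 / 81\<close> and
      \<open>e\<close>.\<close>
    using C by (intro exI[of _ \<epsilon>] exI[of _ C] exI[of _ "\<lambda>_. 0"] conjI) (auto simp: \<epsilon>_def e_def)
qed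

end
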